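(* Let $(\mathcal{M},\mathbb{V})$ and $(\mathcal{N},\mathbb{W})$ be quantum metric spaces and let $\phi\colon \mathcal{M}\to \mathcal{N}$ be a quantum coarse embedding. Then $\operatorname{asdim}(\mathcal{N}) \le \operatorname{asdim}(\mathcal{M})$.
   Context: Von Neumann algebras are concrete: $\mathcal{M}\subseteq\mathcal{B}(\mathcal{H})$, with commutant $\mathcal{M}'$; "projection" means orthogonal projection; $\mathcal{M}\overline{\otimes}\mathcal{B}(\ell_2)$ is the weak*-closed spatial tensor product in $\mathcal{B}(\mathcal{H}\otimes_2\ell_2)$. $\inf\emptyset=\infty$. A quantum metric on $\mathcal{M}\subseteq \mathcal{B}(\mathcal{H})$ is a family $\mathbb{V}=\{\mathcal{V}_t\}_{t\in[0,\infty)}$ of weak*-closed self-adjoint subspaces of $\mathcal{B}(\mathcal{H})$ with $\mathcal{V}_0=\mathcal{M}'$, $\mathcal{V}_s\mathcal{V}_t\subseteq \mathcal{V}_{s+t}$ for all $s,t\ge 0$, and $\mathcal{V}_t=\bigcap_{s>t}\mathcal{V}_s$ for all $t\ge0$. A quantum metric space is a pair $(\mathcal{M},\mathbb{V})$. For projections $P,Q\in\mathcal{M}\overline{\otimes}\mathcal{B}(\ell_2)$, $\operatorname{dist}(P,Q)=\inf\{t \mid P(A\otimes \mathrm{Id})Q\ne0 \text{ for some } A\in\mathcal{V}_t\}$; for $P,Q\in\mathcal{M}$ (identified with $P\otimes\mathrm{Id}$, $Q\otimes \mathrm{Id}$) this is $\inf\{t\mid PAQ\neq0\text{ for some }A\in\mathcal{V}_t\}$.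 For a nonzero projection $P\in\mathcal{M}$, $\operatorname{diam}(P)=\sup\{\operatorname{dist}(Q,R)\mid Q(PAP\otimes\mathrm{Id})R\ne0\text{ for some }A\in\mathcal{B}(\mathcal{H})\}$, with $Q,R$ ranging over projections in $\mathcal{M}\overline{\otimes}\mathcal{B}(\ell_2)$; $\operatorname{diam}(0)=0$. The open $\varepsilon$-neighborhood of a projection $P\in\mathcal{M}$ is $(P)_\varepsilon=\mathrm{Id}-\bigvee\{Q\in\mathcal{M}\text{ projection}\mid \operatorname{dist}(P,Q)\ge\varepsilon\}$. A quantum function $\phi\colon\mathcal{M}\to\mathcal{N}$ is a unital weak*-continuous $*$-homomorphism. For a quantum function between quantum metric spaces and $t\ge 0$, with $P,Q$ ranging over projections in $\mathcal{M}$, put $\tilde\omega_\phi(t)=\inf\{\operatorname{dist}(\phi(P),\phi(Q))\mid\operatorname{dist}(P,Q)\ge t\}$ and $\tilde\rho_\phi(t)=\sup\{\operatorname{diam}(\phi(P))\mid\operatorname{diam}(P)\le t\}$. $\phi$ is a quantum coarse embedding if $\lim_{t\to\infty}\tilde\omega_\phi(t)=\infty$ and $\tilde\rho_\phi(t)<\infty$ for all $t\ge0$. A family $\mathscr{P}$ of projections in $\mathcal{M}$ is a cover if $\bigvee_{P\in\mathscr{P}}P=\mathrm{Id}$; it is $r$-disjoint if $(P)_r(Q)_r=0$ for all distinct $P,Q\in\mathscr{P}$; it is uniformly bounded if $\sup_{P\in\mathscr{P}}\operatorname{diam}(P)\le R$ for some $R>0$. $\operatorname{asdim}(\mathcal{M})\le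 n$ ($n\in\mathbb{N}\cup\{0\}$) if for every $r>0$ there are uniformly bounded, $r$-disjoint families $\mathscr{P}^0,\dots,\mathscr{P}^n$ of projections in $\mathcal{M}$ whose union is a cover for $\mathcal{M}$; $\operatorname{asdim}(\mathcal{M})$ is the least such $n$, and $\infty$ if there is none. *)

theory Defs
  imports "HOL-Analysis.Analysis" "HOL-Library.Extended_Nat"
begin

section \<open>Complex Hilbert spaces\<close>

text \<open>The inner product is conjugate-linear in the first argument. No separability is assumed,
  and the zero space is allowed.\<close>

class chilbert_space = banach +
  fixes scaleC :: "complex \<Rightarrow> 'a \<Rightarrow> 'a" (infixr "*\<^sub>C" 75)
    and cinner :: "'a \<Rightarrow> 'a \<Rightarrow> complex"
  assumes scaleC_add_right: "c *\<^sub>C (x + y) = c *\<^sub>C x + c *\<^sub>C y"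
    and scaleC_add_left: "(c + d) *\<^sub>C x = c *\<^sub>C x + d *\<^sub>C x"
    and scaleC_scaleC: "c *\<^sub>C d *\<^sub>C x = (c * d) *\<^sub>C x"
    and scaleC_of_real: "complex_of_real r *\<^sub>C x = r *\<^sub>R x"
    and cinner_commute: "cinner x y = cnj (cinner y x)"
    and cinner_add_right: "cinner x (y + z) = cinner x y + cinner x z"
    and cinner_scaleC_right: "cinner x (c *\<^sub>C y) = c * cinner x y"
    and cinner_self: "cinner x x = complex_of_real ((norm x)\<^sup>2)"

lemma cinner_add_left: "cinner (x + y) z = cinner x z + cinner y z"
  for x :: "'a::chilbert_space"
  using arg_cong[OF cinner_add_right[of z x y], of cnj] by (simp flip: cinner_commute)

lemma cinner_scaleC_left: "cinner (c *\<^sub>C x) y = cnj c * cinner x y"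
  for x :: "'a::chilbert_space"
  using arg_cong[OF cinner_scaleC_right[of y c x], of cnj] by (simp flip: cinner_commute)

lemma norm_scaleC: "norm (c *\<^sub>C x) = cmod c * norm x" for x :: "'a::chilbert_space"
proof -
  have "complex_of_real ((norm (c *\<^sub>C x))\<^sup>2) = cnj c * c * cinner x x"
    by (simp only: cinner_self[symmetric] cinner_scaleC_left cinner_scaleC_right mult_ac)
  also have "\<dots> = complex_of_real ((cmod c * norm x)\<^sup>2)"
    by (simp only: cinner_self power_mult_distrib of_real_mult complex_norm_square[of c] mult_ac)
  finally have "(norm (c *\<^sub>C x))\<^sup>2 = (cmod c * norm x)\<^sup>2"
    by (simp only: of_real_eq_iff)
  then show ?thesis by (simp add: power2_eq_iff_nonneg)
qed

lemma Re_cinner_le: "Re (cinner x y) \<le> norm x * norm y" for x :: "'a::chilbert_space"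
proof -
  have "complex_of_real ((norm (x + y))\<^sup>2) = cinner (x + y) (x + y)"
    by (simp only: cinner_self)
  also have "\<dots> = cinner x x + cinner y y + (cinner x y + cnj (cinner x y))"
    by (simp add: cinner_add_left cinner_add_right flip: cinner_commute)
  also have "\<dots> = complex_of_real ((norm x)\<^sup>2 + (norm y)\<^sup>2 + 2 * Re (cinner x y))"
    by (simp add: cinner_self complex_add_cnj)
  finally have "(norm (x + y))\<^sup>2 = (norm x)\<^sup>2 + (norm y)\<^sup>2 + 2 * Re (cinner x y)"
    by (simp only: of_real_eq_iff)
  moreover have "(norm (x + y))\<^sup>2 \<le> (norm x + norm y)\<^sup>2"
    by (simp add: norm_triangle_ineq power_mono)
  ultimately show ?thesis by (simp add: power2_sum)
qed

lemma norm_cinner_le: "cmod (cinner x y) \<le> norm x * norm y" for x :: "'a::chilbert_space"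
proof (cases "cinner x y = 0")
  case False
  let ?c = "cnj (sgn (cinner x y))"
  have "cnj (sgn z) * z = cmod z" if "z \<noteq> 0" for z :: complex
  proof -
    have "cnj (sgn z) * z = (z * cnj z) / cmod z" by (simp add: sgn_eq)
    also have "\<dots> = cmod z"
      using that by (simp add: power2_eq_square flip: complex_norm_square)
    finally show ?thesis .
  qed
  then have "cmod (cinner x y) = Re (?c * cinner x y)" using False by simp
  also have "\<dots> \<le> norm x * norm (?c *\<^sub>C y)"
    using Re_cinner_le[of x "?c *\<^sub>C y"] by (simp only: cinner_scaleC_right)
  also have "\<dots> = norm x * norm y"
    using False by (simp add: norm_scaleC norm_sgn)
  finally show ?thesis .
qed simp

instantiation complex :: chilbert_space
begin

definition scaleC_complex :: "complex \<Rightarrow> complex \<Rightarrow> complex"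
  where "scaleC_complex = (*)"

definition cinner_complex :: "complex \<Rightarrow> complex \<Rightarrow> complex"
  where "cinner_complex x y = cnj x * y"

instance
proof
  show "cinner x x = complex_of_real ((norm x)\<^sup>2)" for x :: complex
    by (simp only: cinner_complex_def complex_norm_square mult.commute)
qed (simp_all add: scaleC_complex_def cinner_complex_def algebra_simps scaleR_conv_of_real)

end

section \<open>Square-summable sequences\<close>

text \<open>For a Hilbert space \<open>H\<close> this type is \<open>\<ell>\<^sub>2(\<nat>; H)\<close>. It serves as the model of the
  Hilbert space tensor product of \<open>H\<close> with \<open>\<ell>\<^sub>2\<close>, and \<open>complex l2\<close> is \<open>\<ell>\<^sub>2\<close> itself.\<close>

typedef (overloaded) 'a l2 =
  "{x :: nat \<Rightarrow> 'a::chilbert_space. summable (\<lambda>n. (norm (x n))\<^sup>2)}"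
  morphisms coord Abs_l2
  by (rule exI[of _ "\<lambda>_. 0"]) simp

setup_lifting type_definition_l2

lemma l2_eqI: "(\<And>n. coord x n = coord y n) \<Longrightarrow> x = y"
  by (simp add: coord_inject[symmetric] fun_eq_iff)

lemma summable_coord: "summable (\<lambda>n. (norm (coord x n))\<^sup>2)"
  using coord[of x] by simp

lemma l2_sum_add:
  fixes x y :: "nat \<Rightarrow> 'a::chilbert_space"
  assumes x: "summable (\<lambda>n. (norm (x n))\<^sup>2)" and y: "summable (\<lambda>n. (norm (y n))\<^sup>2)"
  shows "summable (\<lambda>n. (norm (x n + y n))\<^sup>2)"
    and "sqrt (\<Sum>n. (norm (x n + y n))\<^sup>2) \<le>
      sqrt (\<Sum>n. (norm (x n))\<^sup>2) + sqrt (\<Sum>n. (norm (y n))\<^sup>2)"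
proof -
  let ?s = "sqrt (\<Sum>n. (norm (x n))\<^sup>2) + sqrt (\<Sum>n. (norm (y n))\<^sup>2)"
  have s0: "0 \<le> ?s" by (intro add_nonneg_nonneg real_sqrt_ge_zero suminf_nonneg x y zero_le_power2)
  have bound: "(\<Sum>i<n. (norm (x i + y i))\<^sup>2) \<le> ?s\<^sup>2" for n
  proof -
    have "sqrt (\<Sum>i<n. (norm (x i + y i))\<^sup>2) \<le> L2_set (\<lambda>i. norm (x i) + norm (y i)) {..<n}"
      unfolding L2_set_def
      by (rule real_sqrt_le_mono, rule sum_mono, rule power_mono[OF norm_triangle_ineq norm_ge_zero])
    also have "\<dots> \<le> L2_set (\<lambda>i. norm (x i)) {..<n} + L2_set (\<lambda>i. norm (y i)) {..<n}"
      by (rule L2_set_triangle_ineq)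
    also have "\<dots> \<le> ?s"
      unfolding L2_set_def
      by (rule add_mono; rule real_sqrt_le_mono, rule sum_le_suminf) (simp_all add: x y)
    finally show ?thesis
      by (rule sqrt_le_D)
  qed
  show sm: "summable (\<lambda>n. (norm (x n + y n))\<^sup>2)"
    by (rule bounded_imp_summable[of _ "?s\<^sup>2"]) (simp_all only: bound lessThan_Suc_atMost[symmetric] zero_le_power2)
  have "(\<Sum>n. (norm (x n + y n))\<^sup>2) \<le> ?s\<^sup>2"
    by (rule suminf_le_const[OF sm]) (rule bound)
  then show "sqrt (\<Sum>n. (norm (x n + y n))\<^sup>2) \<le> ?s"
    by (rule real_le_lsqrt[OF s0])
qed

lemma l2_summable_scaleC:
  "summable (\<lambda>n. (norm (x n))\<^sup>2) \<Longrightarrow> summable (\<lambda>n. (norm (c *\<^sub>C x n))\<^sup>2)"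
  for x :: "nat \<Rightarrow> 'a::chilbert_space"
  by (simp add: norm_scaleC power_mult_distrib summable_mult)

lemma l2_summable_scaleR:
  "summable (\<lambda>n. (norm (x n))\<^sup>2) \<Longrightarrow> summable (\<lambda>n. (norm (r *\<^sub>R x n))\<^sup>2)"
  for x :: "nat \<Rightarrow> 'a::chilbert_space"
  by (simp add: power_mult_distrib summable_mult)

lemma summable_cinner_coord: "summable (\<lambda>n. cinner (coord x n) (coord y n))"
proof (rule summable_comparison_test')
  show "summable (\<lambda>n. (norm (coord x n))\<^sup>2 + (norm (coord y n))\<^sup>2)"
    by (intro summable_add summable_coord)
  fix n
  have "norm (coord x n) * norm (coord y n) \<le> (norm (coord x n))\<^sup>2 + (norm (coord y n))\<^sup>2"
    using sum_squares_bound[of "norm (coord x n)" "norm (coord y n)"]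
      mult_nonneg_nonneg[OF norm_ge_zero[of "coord x n"] norm_ge_zero[of "coord y n"]]
    by linarith
  with norm_cinner_le[of "coord x n" "coord y n"]
  show "norm (cinner (coord x n) (coord y n)) \<le> (norm (coord x n))\<^sup>2 + (norm (coord y n))\<^sup>2"
    by linarith
qed

instantiation l2 :: (chilbert_space) real_normed_vector
begin

lift_definition zero_l2 :: "'a l2" is "\<lambda>_. 0" by simp
lift_definition plus_l2 :: "'a l2 \<Rightarrow> 'a l2 \<Rightarrow> 'a l2" is "\<lambda>x y n. x n + y n"
  by (rule l2_sum_add)
lift_definition uminus_l2 :: "'a l2 \<Rightarrow> 'a l2" is "\<lambda>x n. - x n" by simp
lift_definition minus_l2 :: "'a l2 \<Rightarrow> 'a l2 \<Rightarrow> 'a l2" is "\<lambda>x y n. x n - y n"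
  subgoal for x y using l2_sum_add(1)[of x "\<lambda>n. - y n"] by simp
  done
lift_definition scaleR_l2 :: "real \<Rightarrow> 'a l2 \<Rightarrow> 'a l2" is "\<lambda>r x n. r *\<^sub>R x n"
  by (rule l2_summable_scaleR)
definition norm_l2 :: "'a l2 \<Rightarrow> real"
  where "norm_l2 x = sqrt (\<Sum>n. (norm (coord x n))\<^sup>2)"
definition dist_l2 :: "'a l2 \<Rightarrow> 'a l2 \<Rightarrow> real"
  where "dist_l2 x y = norm (x - y)"
definition sgn_l2 :: "'a l2 \<Rightarrow> 'a l2"
  where "sgn_l2 x = inverse (norm x) *\<^sub>R x"
definition uniformity_l2 :: "('a l2 \<times> 'a l2) filter"
  where "uniformity_l2 = (INF e\<in>{0<..}. principal {(x, y). dist x y < e})"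
definition open_l2 :: "'a l2 set \<Rightarrow> bool"
  where "open_l2 U \<longleftrightarrow> (\<forall>x\<in>U. \<forall>\<^sub>F (x', y) in uniformity. x' = x \<longrightarrow> y \<in> U)"

lemmas coord_simps =
  zero_l2.rep_eq plus_l2.rep_eq uminus_l2.rep_eq minus_l2.rep_eq scaleR_l2.rep_eq

lemma norm_l2_power2: "(norm x)\<^sup>2 = (\<Sum>n. (norm (coord x n))\<^sup>2)" for x :: "'a l2"
  by (simp add: norm_l2_def suminf_nonneg summable_coord)

lemma norm_coord_le: "norm (coord x n) \<le> norm x" for x :: "'a l2"
proof -
  have "(\<Sum>i\<in>{n}. (norm (coord x i))\<^sup>2) \<le> (norm x)\<^sup>2"
    unfolding norm_l2_power2 by (intro sum_le_suminf summable_coord) auto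
  then show ?thesis
    by (simp add: norm_l2_def real_le_rsqrt suminf_nonneg summable_coord)
qed

instance
proof
  fix x y z :: "'a l2" and a b :: real
  show "x + y + z = x + (y + z)" "x + y = y + x" "0 + x = x" "- x + x = 0" "x - y = x + - y"
    "a *\<^sub>R (x + y) = a *\<^sub>R x + a *\<^sub>R y" "(a + b) *\<^sub>R x = a *\<^sub>R x + b *\<^sub>R x"
    "a *\<^sub>R b *\<^sub>R x = (a * b) *\<^sub>R x" "1 *\<^sub>R x = x"
    by (transfer, simp add: algebra_simps fun_eq_iff)+
  show "dist x y = norm (x - y)" by (rule dist_l2_def)
  show "sgn x = inverse (norm x) *\<^sub>R x" by (rule sgn_l2_def)
  show "uniformity = (INF e\<in>{0<..}. principal {(x :: 'a l2, y). dist x y < e})"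
    by (rule uniformity_l2_def)
  show "open U \<longleftrightarrow> (\<forall>x\<in>U. \<forall>\<^sub>F (x', y) in uniformity. x' = x \<longrightarrow> y \<in> U)" for U :: "'a l2 set"
    by (rule open_l2_def)
  show "norm x = 0 \<longleftrightarrow> x = 0"
  proof
    assume "norm x = 0"
    then have "coord x n = 0" for n using norm_coord_le[of x n] by simp
    then show "x = 0" by (auto intro!: l2_eqI simp: coord_simps)
  qed (simp add: norm_l2_def coord_simps)
  show "norm (x + y) \<le> norm x + norm y"
    unfolding norm_l2_def coord_simps by (intro l2_sum_add summable_coord)
  show "norm (a *\<^sub>R x) = \<bar>a\<bar> * norm x"
    by (simp add: norm_l2_def coord_simps power_mult_distrib suminf_mult summable_coord
        real_sqrt_mult)
qed

end

instance l2 :: (chilbert_space) banach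
proof
  fix X :: "nat \<Rightarrow> 'a l2"
  assume "Cauchy X"
  then have C: "\<exists>N. \<forall>m\<ge>N. \<forall>n\<ge>N. norm (X m - X n) < e" if "e > 0" for e
    using that by (auto simp: Cauchy_def dist_l2_def)
  have "Cauchy (\<lambda>m. coord (X m) k)" for k
  proof (rule metric_CauchyI)
    fix e :: real assume "e > 0"
    then obtain N where N: "\<And>m n. m \<ge> N \<Longrightarrow> n \<ge> N \<Longrightarrow> norm (X m - X n) < e" using C by blast
    show "\<exists>N. \<forall>m\<ge>N. \<forall>n\<ge>N. dist (coord (X m) k) (coord (X n) k) < e"
    proof (intro exI[of _ N] allI impI)
      fix m n assume "m \<ge> N" "n \<ge> N"
      with N norm_coord_le[of "X m - X n" k] show "dist (coord (X m) k) (coord (X n) k) < e"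
        by (fastforce simp: dist_norm coord_simps)
    qed
  qed
  then have "\<exists>l. (\<lambda>m. coord (X m) k) \<longlonglongrightarrow> l" for k
    by (simp add: Cauchy_convergent convergent_def[symmetric])
  then obtain l where l: "\<And>k. (\<lambda>m. coord (X m) k) \<longlonglongrightarrow> l k" by metis
  have fin: "(\<Sum>k<K. (norm (coord (X n) k - l k))\<^sup>2) \<le> e\<^sup>2"
    if N: "\<And>m. m \<ge> N \<Longrightarrow> norm (X n - X m) < e" for n N e K
  proof (rule tendsto_upperbound)
    show "(\<lambda>m. \<Sum>k<K. (norm (coord (X n) k - coord (X m) k))\<^sup>2)
        \<longlonglongrightarrow> (\<Sum>k<K. (norm (coord (X n) k - l k))\<^sup>2)"
      by (intro tendsto_intros l)
    show "\<forall>\<^sub>F m in sequentially. (\<Sum>k<K. (norm (coord (X n) k - coord (X m) k))\<^sup>2) \<le> e\<^sup>2"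
      using eventually_ge_at_top[of N]
    proof eventually_elim
      case (elim m)
      have "(\<Sum>k<K. (norm (coord (X n - X m) k))\<^sup>2) \<le> (norm (X n - X m))\<^sup>2"
        unfolding norm_l2_power2 by (intro sum_le_suminf summable_coord) auto
      also have "\<dots> \<le> e\<^sup>2" using N[OF elim] by (intro power_mono) (auto simp: norm_l2_def suminf_nonneg summable_coord)
      finally show ?case by (simp add: coord_simps)
    qed
  qed simp
  have diff: "summable (\<lambda>k. (norm (coord (X n) k - l k))\<^sup>2)"
    if N: "\<And>m. m \<ge> N \<Longrightarrow> norm (X n - X m) < e" for n N e
    by (rule bounded_imp_summable[of _ "e\<^sup>2"])
      (simp_all only: fin[OF N] lessThan_Suc_atMost[symmetric] zero_le_power2)
  obtain N1 where N1: "\<And>m n. m \<ge> N1 \<Longrightarrow> n \<ge> N1 \<Longrightarrow> norm (X m - X n) < 1" using C[of 1] by auto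
  have "summable (\<lambda>k. (norm (l k - coord (X N1) k))\<^sup>2)"
    using diff[of N1 N1 1] N1 by (simp add: norm_minus_commute)
  from l2_sum_add(1)[OF this summable_coord[of "X N1"]]
  have sl: "summable (\<lambda>k. (norm (l k))\<^sup>2)" by simp
  define L where "L = Abs_l2 l"
  have L: "coord L = l" unfolding L_def using sl by (simp add: Abs_l2_inverse)
  have "X \<longlonglongrightarrow> L"
    unfolding lim_sequentially
  proof (intro allI impI)
    fix e :: real assume e: "e > 0"
    then obtain N where N: "\<And>m n. m \<ge> N \<Longrightarrow> n \<ge> N \<Longrightarrow> norm (X m - X n) < e/2"
      using C[of "e/2"] by auto
    have "dist (X n) L < e" if n: "n \<ge> N" for n
    proof -
      have "(\<Sum>k. (norm (coord (X n) k - l k))\<^sup>2) \<le> (e/2)\<^sup>2"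
        by (rule suminf_le_const[OF diff[of N n "e/2"] fin[of N n "e/2"]]) (use N n in auto)
      then have "norm (X n - L) \<le> e/2"
        unfolding norm_l2_def coord_simps L using e by (intro real_le_lsqrt) auto
      then show ?thesis using e by (simp add: dist_l2_def)
    qed
    then show "\<exists>N. \<forall>n\<ge>N. dist (X n) L < e" by blast
  qed
  then show "convergent X" by (auto simp: convergent_def)
qed

instantiation l2 :: (chilbert_space) chilbert_space
begin

lift_definition scaleC_l2 :: "complex \<Rightarrow> 'a l2 \<Rightarrow> 'a l2" is "\<lambda>c x n. c *\<^sub>C x n"
  by (rule l2_summable_scaleC)
definition cinner_l2 :: "'a l2 \<Rightarrow> 'a l2 \<Rightarrow> complex"
  where "cinner_l2 x y = (\<Sum>n. cinner (coord x n) (coord y n))"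

instance
proof
  fix x y z :: "'a l2" and r :: real and c d :: complex
  show "c *\<^sub>C (x + y) = c *\<^sub>C x + c *\<^sub>C y" "(c + d) *\<^sub>C x = c *\<^sub>C x + d *\<^sub>C x"
    "c *\<^sub>C d *\<^sub>C x = (c * d) *\<^sub>C x" "complex_of_real r *\<^sub>C x = r *\<^sub>R x"
    by (auto intro!: l2_eqI simp: coord_simps scaleC_l2.rep_eq scaleC_add_right scaleC_add_left
        scaleC_scaleC scaleC_of_real)
  show "cinner x y = cnj (cinner y x)"
    unfolding cinner_l2_def
    using bounded_linear.suminf[OF bounded_linear_cnj summable_cinner_coord[of y x]]
    by (simp flip: cinner_commute)
  show "cinner x (y + z) = cinner x y + cinner x z"
    unfolding cinner_l2_def coord_simps scaleC_l2.rep_eq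
    by (simp add: cinner_add_right suminf_add summable_cinner_coord)
  show "cinner x (c *\<^sub>C y) = c * cinner x y"
    unfolding cinner_l2_def coord_simps scaleC_l2.rep_eq
    by (simp add: cinner_scaleC_right suminf_mult summable_cinner_coord)
  show "cinner x x = complex_of_real ((norm x)\<^sup>2)"
    unfolding cinner_l2_def norm_l2_power2 cinner_self
    by (rule suminf_of_real[symmetric]) (rule summable_coord)
qed

end

section \<open>Bounded operators\<close>

text \<open>The library type \<open>\<Rightarrow>\<^sub>L\<close> consists of the bounded real-linear maps, so \<open>B(H)\<close> is carved out
  of it as the set of complex-linear ones.\<close>

definition bounded_ops :: "('h::chilbert_space \<Rightarrow>\<^sub>L 'h) set"
  where "bounded_ops = {T. \<forall>c x. blinfun_apply T (c *\<^sub>C x) = c *\<^sub>C blinfun_apply T x}"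

lift_definition scale_op ::
  "complex \<Rightarrow> ('h::chilbert_space \<Rightarrow>\<^sub>L 'h) \<Rightarrow> ('h \<Rightarrow>\<^sub>L 'h)" is "\<lambda>c T x. c *\<^sub>C T x"
proof -
  fix c :: complex and T :: "'h \<Rightarrow> 'h"
  assume "bounded_linear T"
  then interpret bounded_linear T .
  obtain K where K: "\<And>x. norm (T x) \<le> norm x * K" using bounded by blast
  show "bounded_linear (\<lambda>x. c *\<^sub>C T x)"
  proof (rule bounded_linear_intro[of _ "cmod c * K"])
    show "c *\<^sub>C T (r *\<^sub>R x) = r *\<^sub>R (c *\<^sub>C T x)" for r x
      unfolding scaleR by (simp only: scaleC_of_real[symmetric] scaleC_scaleC mult.commute)
    show "norm (c *\<^sub>C T x) \<le> norm x * (cmod c * K)" for x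
      using mult_left_mono[OF K norm_ge_zero[of c], of x] by (simp add: norm_scaleC mult_ac)
  qed (simp add: add scaleC_add_right)
qed

definition op_subspace :: "('h::chilbert_space \<Rightarrow>\<^sub>L 'h) set \<Rightarrow> bool"
  where "op_subspace V \<longleftrightarrow> V \<subseteq> bounded_ops \<and> 0 \<in> V \<and> (\<forall>S\<in>V. \<forall>T\<in>V. S + T \<in> V) \<and>
    (\<forall>c. \<forall>T\<in>V. scale_op c T \<in> V)"

text \<open>On \<open>bounded_ops\<close> the adjoint exists and is unique by the Riesz representation theorem.\<close>

definition adj :: "('h::chilbert_space \<Rightarrow>\<^sub>L 'h) \<Rightarrow> ('h \<Rightarrow>\<^sub>L 'h)"
  where "adj T = (THE S. \<forall>x y. cinner (blinfun_apply T x) y = cinner x (blinfun_apply S y))"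

lemma cinner_eqI:
  fixes y z :: "'a::chilbert_space"
  assumes "\<And>x. cinner x y = cinner x z"
  shows "y = z"
proof -
  have "cinner (y - z) ((y - z) + z) = cinner (y - z) z" using assms[of "y - z"] by simp
  then have "cinner (y - z) (y - z) = 0" unfolding cinner_add_right by simp
  then show ?thesis unfolding cinner_self by simp
qed

lemma adj_eqI:
  assumes "\<And>x y. cinner (blinfun_apply T x) y = cinner x (blinfun_apply S y)"
  shows "adj T = S"
  unfolding adj_def
proof (rule the_equality)
  fix S'
  assume S': "\<forall>x y. cinner (blinfun_apply T x) y = cinner x (blinfun_apply S' y)"
  have "cinner x (blinfun_apply S' y) = cinner x (blinfun_apply S y)" for x y
    unfolding assms[symmetric] S'[rule_format, symmetric] ..
  then show "S' = S" by (rule blinfun_eqI[OF cinner_eqI])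
qed (simp add: assms)

text \<open>The weak* topology of \<open>B(H)\<close>, as the dual of the trace class operators, is the weakest
  one that makes continuous the functionals \<open>T \<mapsto> \<Sum>n. \<langle>x n, T (y n)\<rangle>\<close> for square-summable
  sequences \<open>x\<close> and \<open>y\<close> in \<open>H\<close>: these are precisely the functionals \<open>T \<mapsto> tr (A T)\<close>
  with \<open>A\<close> trace class.\<close>

definition weakstar :: "('h::chilbert_space \<Rightarrow>\<^sub>L 'h) topology"
  where "weakstar = topology_generated_by
    {{T \<in> bounded_ops. (\<Sum>n. cinner (coord x n) (blinfun_apply T (coord y n))) \<in> U} | x y U. open U}"

section \<open>Von Neumann algebras and projections\<close>

definition von_neumann_algebra :: "('h::chilbert_space \<Rightarrow>\<^sub>L 'h) set \<Rightarrow> bool"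
  where "von_neumann_algebra M \<longleftrightarrow> op_subspace M \<and> id_blinfun \<in> M \<and>
    (\<forall>S\<in>M. \<forall>T\<in>M. S o\<^sub>L T \<in> M) \<and> (\<forall>T\<in>M. adj T \<in> M) \<and> closedin weakstar M"

definition commutant :: "('h::chilbert_space \<Rightarrow>\<^sub>L 'h) set \<Rightarrow> ('h \<Rightarrow>\<^sub>L 'h) set"
  where "commutant M = {T \<in> bounded_ops. \<forall>S\<in>M. S o\<^sub>L T = T o\<^sub>L S}"

definition projection :: "('h::chilbert_space \<Rightarrow>\<^sub>L 'h) \<Rightarrow> bool"
  where "projection P \<longleftrightarrow> P \<in> bounded_ops \<and> P o\<^sub>L P = P \<and> adj P = P"

definition projs :: "('h::chilbert_space \<Rightarrow>\<^sub>L 'h) set \<Rightarrow> ('h \<Rightarrow>\<^sub>L 'h) set"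
  where "projs M = {P \<in> M. projection P}"

definition proj_le :: "('h::chilbert_space \<Rightarrow>\<^sub>L 'h) \<Rightarrow> ('h \<Rightarrow>\<^sub>L 'h) \<Rightarrow> bool"
  where "proj_le P Q \<longleftrightarrow> Q o\<^sub>L P = P"

text \<open>The join is taken in the complete lattice of all projections of \<open>B(H)\<close> (it is the
  projection onto the closed linear span of the ranges). For projections in a von Neumann
  algebra it again lies in the algebra, so it is also the join there.\<close>

definition proj_Sup :: "('h::chilbert_space \<Rightarrow>\<^sub>L 'h) set \<Rightarrow> ('h \<Rightarrow>\<^sub>L 'h)"
  where "proj_Sup \<P> = (THE P. projection P \<and> (\<forall>Q\<in>\<P>. proj_le Q P) \<and>
    (\<forall>R. projection R \<and> (\<forall>Q\<in>\<P>. proj_le Q R) \<longrightarrow> proj_le P R))"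

section \<open>Tensoring with \<open>B(\<ell>\<^sub>2)\<close>\<close>

lift_definition tensor_vec :: "'h::chilbert_space \<Rightarrow> complex l2 \<Rightarrow> 'h l2"
  is "\<lambda>x f n. f n *\<^sub>C x"
  by (simp add: norm_scaleC power_mult_distrib summable_mult2)

text \<open>In this model \<open>T \<otimes> Id\<close> acts coordinatewise (cf. \<open>amplify_tensor_vec\<close>).\<close>

lift_definition amplify_fun :: "('h::chilbert_space \<Rightarrow>\<^sub>L 'h) \<Rightarrow> 'h l2 \<Rightarrow> 'h l2"
  is "\<lambda>T x n. blinfun_apply T (x n)"
  subgoal for T x
  proof (rule summable_comparison_test')
    assume "summable (\<lambda>n. (norm (x n))\<^sup>2)"
    then show "summable (\<lambda>n. (norm T)\<^sup>2 * (norm (x n))\<^sup>2)" by (rule summable_mult)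
    show "norm ((norm (blinfun_apply T (x n)))\<^sup>2) \<le> (norm T)\<^sup>2 * (norm (x n))\<^sup>2" for n
      using power_mono[OF norm_blinfun[of T "x n"] norm_ge_zero, of 2]
      by (simp add: power_mult_distrib)
  qed
  done

lift_definition amplify :: "('h::chilbert_space \<Rightarrow>\<^sub>L 'h) \<Rightarrow> ('h l2 \<Rightarrow>\<^sub>L 'h l2)" is amplify_fun
proof -
  fix T :: "'h \<Rightarrow>\<^sub>L 'h"
  show "bounded_linear (amplify_fun T)"
  proof (rule bounded_linear_intro[of _ "norm T"])
    show "amplify_fun T (x + y) = amplify_fun T x + amplify_fun T y" for x y
      by (rule l2_eqI) (simp add: amplify_fun.rep_eq coord_simps blinfun.add_right)
    show "amplify_fun T (r *\<^sub>R x) = r *\<^sub>R amplify_fun T x" for r x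
      by (rule l2_eqI) (simp add: amplify_fun.rep_eq coord_simps blinfun.scaleR_right)
    show "norm (amplify_fun T x) \<le> norm x * norm T" for x
    proof -
      have "(norm (amplify_fun T x))\<^sup>2 \<le> (\<Sum>n. (norm T)\<^sup>2 * (norm (coord x n))\<^sup>2)"
        unfolding norm_l2_power2
      proof (rule suminf_le)
        show "(norm (coord (amplify_fun T x) n))\<^sup>2 \<le> (norm T)\<^sup>2 * (norm (coord x n))\<^sup>2" for n
          using power_mono[OF norm_blinfun[of T "coord x n"] norm_ge_zero, of 2]
          by (simp add: power_mult_distrib amplify_fun.rep_eq)
      qed (intro summable_coord summable_mult)+
      also have "\<dots> = (norm x * norm T)\<^sup>2"
        by (simp add: suminf_mult summable_coord norm_l2_power2 power_mult_distrib)
      finally show ?thesis by (rule power2_le_imp_le) simp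
    qed
  qed
qed

lemma coord_amplify: "coord (blinfun_apply (amplify T) x) n = blinfun_apply T (coord x n)"
  by (simp add: amplify.rep_eq amplify_fun.rep_eq)

lemma amplify_tensor_vec:
  assumes "T \<in> bounded_ops"
  shows "blinfun_apply (amplify T) (tensor_vec x f) = tensor_vec (blinfun_apply T x) f"
  using assms
  by (intro l2_eqI) (simp add: coord_amplify tensor_vec.rep_eq bounded_ops_def)

lemma amplify_bounded_ops: "T \<in> bounded_ops \<Longrightarrow> amplify T \<in> bounded_ops"
  by (auto simp: bounded_ops_def coord_amplify scaleC_l2.rep_eq intro!: l2_eqI)

lemma amplify_compose: "amplify (S o\<^sub>L T) = amplify S o\<^sub>L amplify T"
  by (intro blinfun_eqI l2_eqI) (simp add: coord_amplify)

lemma amplify_eq_0_iff: "amplify T = 0 \<longleftrightarrow> T = 0"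
proof
  assume T: "amplify T = 0"
  have "blinfun_apply T x = 0" for x
  proof -
    have s: "summable (\<lambda>n. (norm (if n = 0 then x else 0))\<^sup>2)"
      by (rule summable_finite[of "{0}"]) auto
    define y where "y = Abs_l2 (\<lambda>n::nat. if n = 0 then x else 0)"
    have "coord y 0 = x" unfolding y_def using s by (subst Abs_l2_inverse) auto
    then show ?thesis using coord_amplify[of T y 0] by (simp add: T coord_simps)
  qed
  then show "T = 0" by (intro blinfun_eqI) simp
next
  assume "T = 0"
  then show "amplify T = 0"
    by (intro blinfun_eqI l2_eqI) (simp add: coord_amplify coord_simps)
qed

text \<open>For \<open>A\<close>, \<open>B\<close> in \<open>bounded_ops\<close> the operator \<open>A \<otimes> B\<close> is the unique bounded \<open>T\<close> with
  \<open>T (x \<otimes> f) = A x \<otimes> B f\<close>. The set below is the weak*-closed linear span of the operators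
  \<open>A \<otimes> B\<close> with \<open>A\<close> in \<open>M\<close> and \<open>B\<close> in \<open>B(\<ell>\<^sub>2)\<close>.\<close>

definition vn_tensor :: "('h::chilbert_space \<Rightarrow>\<^sub>L 'h) set \<Rightarrow> ('h l2 \<Rightarrow>\<^sub>L 'h l2) set"
  where "vn_tensor M = (\<lambda>S. op_subspace S \<and> closedin weakstar S) hull
    {T \<in> bounded_ops. \<exists>A\<in>M. \<exists>B\<in>bounded_ops.
      \<forall>x f. blinfun_apply T (tensor_vec x f) = tensor_vec (blinfun_apply A x) (blinfun_apply B f)}"

section \<open>Quantum metric spaces\<close>

text \<open>Only the values of \<open>V\<close> on nonnegative reals are relevant.\<close>

definition quantum_metric ::
  "('h::chilbert_space \<Rightarrow>\<^sub>L 'h) set \<Rightarrow> (real \<Rightarrow> ('h \<Rightarrow>\<^sub>L 'h) set) \<Rightarrow> bool"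
  where "quantum_metric M V \<longleftrightarrow>
    (\<forall>t\<ge>0. op_subspace (V t) \<and> closedin weakstar (V t) \<and> (\<forall>A\<in>V t. adj A \<in> V t)) \<and>
    V 0 = commutant M \<and>
    (\<forall>s\<ge>0. \<forall>t\<ge>0. \<forall>A\<in>V s. \<forall>B\<in>V t. A o\<^sub>L B \<in> V (s + t)) \<and>
    (\<forall>t\<ge>0. V t = (\<Inter>s\<in>{t<..}. V s))"

definition quantum_metric_space ::
  "('h::chilbert_space \<Rightarrow>\<^sub>L 'h) set \<Rightarrow> (real \<Rightarrow> ('h \<Rightarrow>\<^sub>L 'h) set) \<Rightarrow> bool"
  where "quantum_metric_space M V \<longleftrightarrow> von_neumann_algebra M \<and> quantum_metric M V"

text \<open>Distances and diameters live in \<open>ennreal\<close>, where the infimum of the empty set is \<open>\<infinity>\<close>.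
  \<open>qdist\<close> is the distance between projections of \<open>vn_tensor M\<close>, and \<open>mdist\<close> the one
  between projections of \<open>M\<close>.\<close>

definition qdist :: "(real \<Rightarrow> ('h::chilbert_space \<Rightarrow>\<^sub>L 'h) set) \<Rightarrow>
    ('h l2 \<Rightarrow>\<^sub>L 'h l2) \<Rightarrow> ('h l2 \<Rightarrow>\<^sub>L 'h l2) \<Rightarrow> ennreal"
  where "qdist V P Q = Inf {ennreal t | t. 0 \<le> t \<and> (\<exists>A\<in>V t. P o\<^sub>L amplify A o\<^sub>L Q \<noteq> 0)}"

definition mdist :: "(real \<Rightarrow> ('h::chilbert_space \<Rightarrow>\<^sub>L 'h) set) \<Rightarrow>
    ('h \<Rightarrow>\<^sub>L 'h) \<Rightarrow> ('h \<Rightarrow>\<^sub>L 'h) \<Rightarrow> ennreal"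
  where "mdist V P Q = qdist V (amplify P) (amplify Q)"

lemma mdist_eq: "mdist V P Q = Inf {ennreal t | t. 0 \<le> t \<and> (\<exists>A\<in>V t. P o\<^sub>L A o\<^sub>L Q \<noteq> 0)}"
  by (simp add: mdist_def qdist_def amplify_eq_0_iff flip: amplify_compose)

definition diam :: "('h::chilbert_space \<Rightarrow>\<^sub>L 'h) set \<Rightarrow> (real \<Rightarrow> ('h \<Rightarrow>\<^sub>L 'h) set) \<Rightarrow>
    ('h \<Rightarrow>\<^sub>L 'h) \<Rightarrow> ennreal"
  where "diam M V P = (if P = 0 then 0 else
    Sup {qdist V Q R | Q R. Q \<in> projs (vn_tensor M) \<and> R \<in> projs (vn_tensor M) \<and>
      (\<exists>A\<in>bounded_ops. Q o\<^sub>L amplify (P o\<^sub>L A o\<^sub>L P) o\<^sub>L R \<noteq> 0)})"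

definition nbhd :: "('h::chilbert_space \<Rightarrow>\<^sub>L 'h) set \<Rightarrow> (real \<Rightarrow> ('h \<Rightarrow>\<^sub>L 'h) set) \<Rightarrow>
    real \<Rightarrow> ('h \<Rightarrow>\<^sub>L 'h) \<Rightarrow> ('h \<Rightarrow>\<^sub>L 'h)"
  where "nbhd M V \<epsilon> P = id_blinfun - proj_Sup {Q \<in> projs M. mdist V P Q \<ge> ennreal \<epsilon>}"

section \<open>Quantum coarse embeddings\<close>

definition quantum_function :: "('h::chilbert_space \<Rightarrow>\<^sub>L 'h) set \<Rightarrow>
    ('k::chilbert_space \<Rightarrow>\<^sub>L 'k) set \<Rightarrow> (('h \<Rightarrow>\<^sub>L 'h) \<Rightarrow> ('k \<Rightarrow>\<^sub>L 'k)) \<Rightarrow> bool"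
  where "quantum_function M N \<phi> \<longleftrightarrow> \<phi> ` M \<subseteq> N \<and>
    (\<forall>S\<in>M. \<forall>T\<in>M. \<phi> (S + T) = \<phi> S + \<phi> T) \<and>
    (\<forall>c. \<forall>T\<in>M. \<phi> (scale_op c T) = scale_op c (\<phi> T)) \<and>
    (\<forall>S\<in>M. \<forall>T\<in>M. \<phi> (S o\<^sub>L T) = \<phi> S o\<^sub>L \<phi> T) \<and>
    (\<forall>T\<in>M. \<phi> (adj T) = adj (\<phi> T)) \<and>
    \<phi> id_blinfun = id_blinfun \<and>
    continuous_map (subtopology weakstar M) (subtopology weakstar N) \<phi>"

definition omega :: "('h::chilbert_space \<Rightarrow>\<^sub>L 'h) set \<Rightarrow> (real \<Rightarrow> ('h \<Rightarrow>\<^sub>L 'h) set) \<Rightarrow>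
    (real \<Rightarrow> ('k::chilbert_space \<Rightarrow>\<^sub>L 'k) set) \<Rightarrow> (('h \<Rightarrow>\<^sub>L 'h) \<Rightarrow> ('k \<Rightarrow>\<^sub>L 'k)) \<Rightarrow> real \<Rightarrow> ennreal"
  where "omega M V W \<phi> t =
    Inf {mdist W (\<phi> P) (\<phi> Q) | P Q. P \<in> projs M \<and> Q \<in> projs M \<and> mdist V P Q \<ge> ennreal t}"

definition rho :: "('h::chilbert_space \<Rightarrow>\<^sub>L 'h) set \<Rightarrow> (real \<Rightarrow> ('h \<Rightarrow>\<^sub>L 'h) set) \<Rightarrow>
    ('k::chilbert_space \<Rightarrow>\<^sub>L 'k) set \<Rightarrow> (real \<Rightarrow> ('k \<Rightarrow>\<^sub>L 'k) set) \<Rightarrow>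
    (('h \<Rightarrow>\<^sub>L 'h) \<Rightarrow> ('k \<Rightarrow>\<^sub>L 'k)) \<Rightarrow> real \<Rightarrow> ennreal"
  where "rho M V N W \<phi> t = Sup {diam N W (\<phi> P) | P. P \<in> projs M \<and> diam M V P \<le> ennreal t}"

definition quantum_coarse_embedding ::
  "('h::chilbert_space \<Rightarrow>\<^sub>L 'h) set \<Rightarrow> (real \<Rightarrow> ('h \<Rightarrow>\<^sub>L 'h) set) \<Rightarrow>
    ('k::chilbert_space \<Rightarrow>\<^sub>L 'k) set \<Rightarrow> (real \<Rightarrow> ('k \<Rightarrow>\<^sub>L 'k) set) \<Rightarrow>
    (('h \<Rightarrow>\<^sub>L 'h) \<Rightarrow> ('k \<Rightarrow>\<^sub>L 'k)) \<Rightarrow> bool"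
  where "quantum_coarse_embedding M V N W \<phi> \<longleftrightarrow> quantum_function M N \<phi> \<and>
    (omega M V W \<phi> \<longlongrightarrow> \<infinity>) at_top \<and> (\<forall>t\<ge>0. rho M V N W \<phi> t < \<infinity>)"

section \<open>Asymptotic dimension\<close>

definition is_cover :: "('h::chilbert_space \<Rightarrow>\<^sub>L 'h) set \<Rightarrow> bool"
  where "is_cover \<P> \<longleftrightarrow> proj_Sup \<P> = id_blinfun"

definition r_disjoint :: "('h::chilbert_space \<Rightarrow>\<^sub>L 'h) set \<Rightarrow> (real \<Rightarrow> ('h \<Rightarrow>\<^sub>L 'h) set) \<Rightarrow>
    real \<Rightarrow> ('h \<Rightarrow>\<^sub>L 'h) set \<Rightarrow> bool"
  where "r_disjoint M V r \<P> \<longleftrightarrow>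
    (\<forall>P\<in>\<P>. \<forall>Q\<in>\<P>. P \<noteq> Q \<longrightarrow> nbhd M V r P o\<^sub>L nbhd M V r Q = 0)"

definition uniformly_bounded :: "('h::chilbert_space \<Rightarrow>\<^sub>L 'h) set \<Rightarrow>
    (real \<Rightarrow> ('h \<Rightarrow>\<^sub>L 'h) set) \<Rightarrow> ('h \<Rightarrow>\<^sub>L 'h) set \<Rightarrow> bool"
  where "uniformly_bounded M V \<P> \<longleftrightarrow> (\<exists>R>0. (SUP P\<in>\<P>. diam M V P) \<le> ennreal R)"

definition asdim_le :: "('h::chilbert_space \<Rightarrow>\<^sub>L 'h) set \<Rightarrow> (real \<Rightarrow> ('h \<Rightarrow>\<^sub>L 'h) set) \<Rightarrow>
    nat \<Rightarrow> bool"
  where "asdim_le M V n \<longleftrightarrow> (\<forall>r>0. \<exists>\<P> :: nat \<Rightarrow> ('h \<Rightarrow>\<^sub>L 'h) set.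
    (\<forall>i\<le>n. \<P> i \<subseteq> projs M \<and> uniformly_bounded M V (\<P> i) \<and> r_disjoint M V r (\<P> i)) \<and>
    is_cover (\<Union>i\<le>n. \<P> i))"

definition asdim :: "('h::chilbert_space \<Rightarrow>\<^sub>L 'h) set \<Rightarrow> (real \<Rightarrow> ('h \<Rightarrow>\<^sub>L 'h) set) \<Rightarrow> enat"
  where "asdim M V = Inf {enat n | n. asdim_le M V n}"

end

theory Submission
  imports Defs
begin

text \<open>Images under \<open>\<phi>\<close> of the families witnessing \<open>asdim_le M V n\<close> at a large scale \<open>s\<close>
  witness \<open>asdim_le N W n\<close> at scale \<open>r\<close>: the bound on \<open>rho\<close> keeps them uniformly bounded, and
  \<open>omega M V W \<phi> s > r\<close> gives \<open>(\<phi> P)\<^sub>r \<le> \<phi> ((P)\<^sub>s)\<close>, hence disjointness. Both this inequality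
  and the covering property need that \<open>\<phi>\<close> does not increase joins beyond the join of the images.
  For a projection \<open>E\<close> above all \<open>\<phi> Q\<close>, the operators \<open>T\<close> with \<open>E (\<phi> T) = \<phi> T\<close> form a
  weak*-closed right ideal of \<open>M\<close>, and such an ideal contains the join of its projections.\<close>

section \<open>Orthogonal projections\<close>

lemma cinner_scaleR_right: "cinner x (r *\<^sub>R y) = r *\<^sub>R cinner x y"
  for x :: "'a::chilbert_space"
  by (simp add: cinner_scaleC_right scaleR_conv_of_real flip: scaleC_of_real)

lemma bounded_linear_cinner: "bounded_linear (cinner x)"
  for x :: "'a::chilbert_space"
  by (rule bounded_linear_intro[of _ "norm x"])
    (simp_all add: cinner_add_right cinner_scaleR_right norm_cinner_le mult.commute[of _ "norm x"])

lemma bounded_linear_scaleC: "bounded_linear (\<lambda>x. c *\<^sub>C x)"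
  for c :: complex
  by (rule bounded_linear_intro[of _ "cmod c"])
    (simp_all add: scaleC_add_right norm_scaleC mult.commute scaleC_scaleC flip: scaleC_of_real)

lemma scaleC_zero_right [simp]: "c *\<^sub>C (0 :: 'a) = 0"
  and scaleC_diff_right: "c *\<^sub>C (x - y) = c *\<^sub>C x - c *\<^sub>C y"
  for x :: "'a::chilbert_space"
proof -
  interpret bounded_linear "\<lambda>x :: 'a. c *\<^sub>C x" by (rule bounded_linear_scaleC)
  show "c *\<^sub>C 0 = (0 :: 'a)" by (rule zero)
  show "c *\<^sub>C (x - y) = c *\<^sub>C x - c *\<^sub>C y" for x y :: 'a by (rule diff)
qed

lemma cinner_zero_right [simp]: "cinner x 0 = 0"
  and cinner_diff_right: "cinner x (y - z) = cinner x y - cinner x z"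
  and cinner_minus_right: "cinner x (- y) = - cinner x y"
  and cinner_eq_0_commute: "cinner x y = 0 \<longleftrightarrow> cinner y x = 0"
  for x :: "'a::chilbert_space"
proof -
  interpret bounded_linear "cinner x" by (rule bounded_linear_cinner)
  show "cinner x 0 = 0" "cinner x (y - z) = cinner x y - cinner x z"
    "cinner x (- y) = - cinner x y"
    by (rule zero diff neg)+
  show "cinner x y = 0 \<longleftrightarrow> cinner y x = 0"
    by (metis cinner_commute complex_cnj_zero)
qed

lemma cinner_diff_left: "cinner (x - y) z = cinner x z - cinner y z"
  for x :: "'a::chilbert_space"
  using cinner_add_left[of "x - y" y z] by simp

lemma scaleC_minus1: "(-1) *\<^sub>C x = - x" for x :: "'a::chilbert_space"
  using scaleC_of_real[of "-1" x] by simp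

lemma cinner_self_eq_0 [simp]: "cinner x x = 0 \<longleftrightarrow> x = 0" for x :: "'a::chilbert_space"
  by (simp add: cinner_self)

lemma norm_add_power2:
  "(norm (x + y))\<^sup>2 = (norm x)\<^sup>2 + (norm y)\<^sup>2 + 2 * Re (cinner x y)"
  for x :: "'a::chilbert_space"
proof -
  have "complex_of_real ((norm (x + y))\<^sup>2) = cinner x x + cinner y y + (cinner x y + cnj (cinner x y))"
    by (simp only: cinner_add_left cinner_add_right flip: cinner_commute cinner_self) simp
  also have "\<dots> = complex_of_real ((norm x)\<^sup>2 + (norm y)\<^sup>2 + 2 * Re (cinner x y))"
    by (simp add: cinner_self complex_add_cnj)
  finally show ?thesis by (simp only: of_real_eq_iff)
qed

lemma parallelogram:
  "(norm (x + y))\<^sup>2 + (norm (x - y))\<^sup>2 = 2 * (norm x)\<^sup>2 + 2 * (norm y)\<^sup>2"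
  for x :: "'a::chilbert_space"
  using norm_add_power2[of x y] norm_add_power2[of x "- y"] by (simp add: cinner_minus_right)

section \<open>Nearest points, Riesz representation and adjoints\<close>

definition closed_csubspace :: "'a::chilbert_space set \<Rightarrow> bool"
  where "closed_csubspace K \<longleftrightarrow> closed K \<and> 0 \<in> K \<and> (\<forall>x\<in>K. \<forall>y\<in>K. x + y \<in> K) \<and>
    (\<forall>c. \<forall>x\<in>K. c *\<^sub>C x \<in> K)"

lemma closed_csubspaceD:
  assumes "closed_csubspace K"
  shows "closed K" and "0 \<in> K" and "x \<in> K \<Longrightarrow> y \<in> K \<Longrightarrow> x + y \<in> K"
    and "x \<in> K \<Longrightarrow> c *\<^sub>C x \<in> K" and "x \<in> K \<Longrightarrow> y \<in> K \<Longrightarrow> x - y \<in> K"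
    and "x \<in> K \<Longrightarrow> r *\<^sub>R x \<in> K"
proof -
  show "closed K" "0 \<in> K" "x \<in> K \<Longrightarrow> c *\<^sub>C x \<in> K"
    using assms by (auto simp: closed_csubspace_def)
  show *: "x + y \<in> K" if "x \<in> K" "y \<in> K" for x y
    using that assms by (auto simp: closed_csubspace_def)
  have "- y \<in> K" if "y \<in> K" for y
    using that assms by (metis closed_csubspace_def scaleC_minus1)
  then show "x \<in> K \<Longrightarrow> y \<in> K \<Longrightarrow> x - y \<in> K" using *[of x "- y"] by simp
  show "x \<in> K \<Longrightarrow> r *\<^sub>R x \<in> K"
    using assms by (auto simp: closed_csubspace_def simp flip: scaleC_of_real)
qed

text \<open>A minimizing sequence is Cauchy by the parallelogram law, because midpoints of its
  members stay in \<open>K\<close> and so cannot come closer to \<open>x\<close> than the infimum.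
  Completeness and closedness then provide the minimizer.\<close>

lemma closest_point_exists:
  fixes x :: "'a::chilbert_space"
  assumes K: "closed_csubspace K"
  obtains k where "k \<in> K" and "\<And>z. z \<in> K \<Longrightarrow> norm (x - k) \<le> norm (x - z)"
proof -
  define D where "D = (\<lambda>z. (norm (x - z))\<^sup>2) ` K"
  define d where "d = Inf D"
  have bdd: "bdd_below D" by (rule bdd_belowI[of _ 0]) (auto simp: D_def)
  have ne: "D \<noteq> {}" using closed_csubspaceD(2)[OF K] by (auto simp: D_def)
  have d_le: "d \<le> (norm (x - z))\<^sup>2" if "z \<in> K" for z
    unfolding d_def using that bdd by (auto intro: cInf_lower simp: D_def)
  have "\<exists>z\<in>K. (norm (x - z))\<^sup>2 < d + e" if "e > 0" for e
    using cInf_lessD[OF ne, of "d + e"] that by (auto simp: D_def d_def)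
  then have "\<exists>z\<in>K. (norm (x - z))\<^sup>2 < d + inverse (real (Suc n))" for n
    by simp
  then obtain k where kK: "\<And>n. k n \<in> K"
    and k: "\<And>n. (norm (x - k n))\<^sup>2 < d + inverse (real (Suc n))" by metis
  \<comment> \<open>The parallelogram law for \<open>x - k m\<close> and \<open>x - k n\<close>: the
    two squared distances contribute at most \<open>4 * d\<close> plus the error terms, and the
    midpoint bound takes \<open>4 * d\<close> away again.\<close>
  have close: "(norm (k m - k n))\<^sup>2 \<le> 4 * inverse (real (Suc N))" if "m \<ge> N" "n \<ge> N" for m n N
  proof -
    have mid: "(1/2) *\<^sub>R (k m + k n) \<in> K" by (intro closed_csubspaceD[OF K] kK)
    have "(x - k m) + (x - k n) = 2 *\<^sub>R (x - (1/2) *\<^sub>R (k m + k n))"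
      by (simp add: algebra_simps scaleR_2)
    then have "(norm ((x - k m) + (x - k n)))\<^sup>2 = 4 * (norm (x - (1/2) *\<^sub>R (k m + k n)))\<^sup>2"
      by (simp only: norm_scaleR power_mult_distrib) simp
    with d_le[OF mid] have "4 * d \<le> (norm ((x - k m) + (x - k n)))\<^sup>2" by simp
    moreover have diff: "norm ((x - k m) - (x - k n)) = norm (k m - k n)"
      by (simp add: norm_minus_commute)
    moreover have "inverse (real (Suc m)) \<le> inverse (real (Suc N))"
      "inverse (real (Suc n)) \<le> inverse (real (Suc N))"
      using that by (auto intro!: le_imp_inverse_le)
    ultimately show ?thesis
      using parallelogram[of "x - k m" "x - k n"] k[of m] k[of n]
      unfolding diff by linarith
  qed
  have "Cauchy k"
  proof (rule metric_CauchyI)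
    fix e :: real assume e: "e > 0"
    then obtain N where N: "inverse (real (Suc N)) < e\<^sup>2 / 4"
      using reals_Archimedean[of "e\<^sup>2 / 4"] by auto
    show "\<exists>N. \<forall>m\<ge>N. \<forall>n\<ge>N. dist (k m) (k n) < e"
    proof (intro exI[of _ N] allI impI)
      fix m n assume "m \<ge> N" "n \<ge> N"
      from close[OF this] N have "(norm (k m - k n))\<^sup>2 < e\<^sup>2" by linarith
      with e show "dist (k m) (k n) < e"
        by (simp add: dist_norm power2_less_imp_less)
    qed
  qed
  then obtain l where l: "k \<longlonglongrightarrow> l" by (auto simp: Cauchy_convergent_iff convergent_def)
  have lK: "l \<in> K"
    using closed_sequentially[OF closed_csubspaceD(1)[OF K] _ l] kK by blast
  have "(\<lambda>n. (norm (x - k n))\<^sup>2) \<longlonglongrightarrow> (norm (x - l))\<^sup>2" by (intro tendsto_intros l)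
  moreover have "(\<lambda>n. d + inverse (real (Suc n))) \<longlonglongrightarrow> d + 0"
    by (intro tendsto_intros LIMSEQ_inverse_real_of_nat)
  ultimately have le_d: "(norm (x - l))\<^sup>2 \<le> d + 0"
    by (rule LIMSEQ_le) (use k less_imp_le in blast)
  have "norm (x - l) \<le> norm (x - z)" if "z \<in> K" for z
    using le_d d_le[OF that] by (intro power2_le_imp_le[OF _ norm_ge_zero]) linarith
  with lK show thesis by (rule that)
qed

text \<open>For the nearest point \<open>k\<close>, a nonzero component of \<open>x - k\<close>
  along some \<open>z\<close> in \<open>K\<close> could be moved into \<open>k\<close>, which would
  give a strictly closer point.\<close>

lemma orthogonal_decomposition:
  fixes x :: "'a::chilbert_space"
  assumes K: "closed_csubspace K"
  obtains k where "k \<in> K" and "\<And>z. z \<in> K \<Longrightarrow> cinner z (x - k) = 0"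
proof -
  obtain k where k: "k \<in> K" and min: "\<And>z. z \<in> K \<Longrightarrow> norm (x - k) \<le> norm (x - z)"
    using closest_point_exists[OF K] by blast
  have "cinner z (x - k) = 0" if z: "z \<in> K" for z
  proof (cases "z = 0")
    case True
    then show ?thesis using cinner_eq_0_commute[of z "x - k"] by simp
  next
    case False
    define w where "w = x - k"
    \<comment> \<open>The coefficient of the orthogonal projection of \<open>w\<close> onto the line
      of \<open>z\<close>; what is left of \<open>w\<close> is orthogonal to \<open>z\<close>, so
      Pythagoras applies.\<close>
    define c where "c = cinner z w / complex_of_real ((norm z)\<^sup>2)"
    have "norm w \<le> norm (w - c *\<^sub>C z)"
      using min[of "k + c *\<^sub>C z"] closed_csubspaceD(3,4)[OF K] k z by (simp add: w_def algebra_simps)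
    then have "(norm w)\<^sup>2 \<le> (norm (w - c *\<^sub>C z))\<^sup>2" by (simp add: power_mono)
    moreover have "(norm w)\<^sup>2 = (norm (w - c *\<^sub>C z))\<^sup>2 + (norm (c *\<^sub>C z))\<^sup>2"
    proof -
      have "cinner z (w - c *\<^sub>C z) = 0"
        using False by (simp add: cinner_diff_right cinner_scaleC_right c_def cinner_self)
      then have "cinner (w - c *\<^sub>C z) (c *\<^sub>C z) = 0"
        by (simp add: cinner_scaleC_right cinner_eq_0_commute[of "w - c *\<^sub>C z"])
      then show ?thesis using norm_add_power2[of "w - c *\<^sub>C z" "c *\<^sub>C z"] by simp
    qed
    ultimately have "c *\<^sub>C z = 0" by simp
    then have "c = 0" using False by (metis norm_scaleC mult_eq_0_iff norm_eq_zero)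
    then show ?thesis using False by (simp add: c_def w_def)
  qed
  with k show thesis by (rule that)
qed

text \<open>The kernel of a nonzero \<open>f\<close> is a closed subspace. A vector \<open>w\<close>
  orthogonal to it with \<open>f w\<close> nonzero determines \<open>f\<close> up to the scaling
  that makes both sides agree at \<open>w\<close>.\<close>

lemma riesz:
  fixes f :: "'a::chilbert_space \<Rightarrow> complex"
  assumes f: "bounded_linear f" and fC: "\<And>c x. f (c *\<^sub>C x) = c * f x"
  obtains u where "\<And>x. f x = cinner u x"
proof (cases "\<forall>x. f x = 0")
  case True
  then show thesis by (intro that[of 0]) (simp add: cinner_eq_0_commute[of 0])
next
  case False
  then obtain x0 where x0: "f x0 \<noteq> 0" by blast
  interpret bounded_linear f by fact
  have "closed {x. f x = 0}"
    by (intro closed_Collect_eq continuous_on continuous_on_id continuous_on_const)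
  then have Z: "closed_csubspace {x. f x = 0}"
    by (simp add: closed_csubspace_def zero add fC)
  obtain k where "k \<in> {x. f x = 0}" and "\<And>z. z \<in> {x. f x = 0} \<Longrightarrow> cinner z (x0 - k) = 0"
    using orthogonal_decomposition[OF Z, of x0] by metis
  then have k: "f k = 0" and orth: "\<And>z. f z = 0 \<Longrightarrow> cinner z (x0 - k) = 0"
    by simp_all
  define w where "w = x0 - k"
  have fw: "f w \<noteq> 0" using x0 k by (simp add: w_def diff)
  have w0: "w \<noteq> 0" using fw zero by auto
  have "f x = cinner (cnj (f w / complex_of_real ((norm w)\<^sup>2)) *\<^sub>C w) x" for x
  proof -
    \<comment> \<open>Subtracting this multiple of \<open>w\<close> moves \<open>x\<close> into the
      kernel, where orthogonality to \<open>w\<close> is known.\<close>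
    have "f (x - (f x / f w) *\<^sub>C w) = 0" using fw by (simp add: diff fC)
    then have "cinner w (x - (f x / f w) *\<^sub>C w) = 0"
      using orth cinner_eq_0_commute unfolding w_def by blast
    then have "cinner w x = f x / f w * complex_of_real ((norm w)\<^sup>2)"
      by (simp add: cinner_diff_right cinner_scaleC_right cinner_self)
    then show ?thesis using fw w0 by (simp add: cinner_scaleC_left)
  qed
  then show thesis by (rule that)
qed

text \<open>\<open>adj\<close> is a definite description, so its defining identity requires
  existence. For each \<open>y\<close>, Riesz represents the functional sending \<open>x\<close> to
  <y, T x> by a vector \<open>S y\<close>; this \<open>S\<close> is bounded and linear, and
  \<open>adj_eqI\<close> identifies it with \<open>adj T\<close>.\<close>

lemma cinner_adj:
  assumes T: "T \<in> bounded_ops"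
  shows "cinner (blinfun_apply T x) y = cinner x (blinfun_apply (adj T) y)"
proof -
  have "\<exists>u. \<forall>x. cinner y (blinfun_apply T x) = cinner u x" for y
  proof -
    have "bounded_linear (\<lambda>x. cinner y (blinfun_apply T x))"
      by (rule bounded_linear_compose[OF bounded_linear_cinner blinfun.bounded_linear_right])
    moreover have "cinner y (blinfun_apply T (c *\<^sub>C x)) = c * cinner y (blinfun_apply T x)" for c x
      using T by (simp add: bounded_ops_def cinner_scaleC_right)
    ultimately show ?thesis using riesz by metis
  qed
  then obtain S where "\<And>y x. cinner y (blinfun_apply T x) = cinner (S y) x" by metis
  then have S: "cinner (blinfun_apply T x) y = cinner x (S y)" for x y
    by (metis cinner_commute)
  have "bounded_linear S"
  proof (rule bounded_linear_intro[of _ "norm T"])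
    show "S (x + y) = S x + S y" for x y
      by (rule cinner_eqI) (simp add: cinner_add_right flip: S)
    show "S (r *\<^sub>R x) = r *\<^sub>R S x" for r x
      by (rule cinner_eqI) (simp add: cinner_scaleR_right flip: S)
    show "norm (S y) \<le> norm y * norm T" for y
    proof (cases "S y = 0")
      case False
      have "(norm (S y))\<^sup>2 = cmod (cinner (blinfun_apply T (S y)) y)"
        by (simp add: S cinner_self norm_power)
      also have "\<dots> \<le> norm (blinfun_apply T (S y)) * norm y" by (rule norm_cinner_le)
      also have "\<dots> \<le> norm T * norm (S y) * norm y"
        by (intro mult_right_mono norm_blinfun) simp
      finally show ?thesis using False by (simp add: power2_eq_square mult_ac)
    qed simp
  qed
  then have "adj T = Blinfun S" by (intro adj_eqI) (simp add: bounded_linear_Blinfun_apply S)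
  with \<open>bounded_linear S\<close> show ?thesis by (simp add: bounded_linear_Blinfun_apply S)
qed

section \<open>Self-adjoint idempotents and projections onto closed subspaces\<close>

lemma projectionD:
  assumes "projection P"
  shows "P \<in> bounded_ops" and "blinfun_apply P (blinfun_apply P x) = blinfun_apply P x"
    and "cinner (blinfun_apply P x) y = cinner x (blinfun_apply P y)"
proof -
  show *: "P \<in> bounded_ops" using assms by (simp add: projection_def)
  show "blinfun_apply P (blinfun_apply P x) = blinfun_apply P x"
    using assms by (metis projection_def blinfun_apply_blinfun_compose)
  show "cinner (blinfun_apply P x) y = cinner x (blinfun_apply P y)"
    using cinner_adj[OF *] assms by (simp add: projection_def)
qed

lemma projectionI:
  assumes "P \<in> bounded_ops" and "\<And>x. blinfun_apply P (blinfun_apply P x) = blinfun_apply P x"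
    and "\<And>x y. cinner (blinfun_apply P x) y = cinner x (blinfun_apply P y)"
  shows "projection P"
  using assms by (auto simp: projection_def intro!: blinfun_eqI adj_eqI)

lemma projection_id_minus:
  assumes "projection P"
  shows "projection (id_blinfun - P)"
proof (rule projectionI)
  show "id_blinfun - P \<in> bounded_ops"
    using projectionD(1)[OF assms]
    by (simp add: bounded_ops_def blinfun.diff_left scaleC_diff_right)
  show "cinner (blinfun_apply (id_blinfun - P) x) y = cinner x (blinfun_apply (id_blinfun - P) y)"
    for x y
    by (simp add: blinfun.diff_left cinner_diff_left cinner_diff_right projectionD(3)[OF assms])
qed (simp add: blinfun.diff_left blinfun.diff_right projectionD(2)[OF assms])

text \<open>Choosing the orthogonal decomposition pointwise gives a map \<open>p\<close>; uniqueness
  of the decomposition makes it linear.\<close>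

lemma projection_onto:
  fixes K :: "'a::chilbert_space set"
  assumes K: "closed_csubspace K"
  obtains P where "projection P" and "range (blinfun_apply P) \<subseteq> K"
    and "\<And>x. x \<in> K \<Longrightarrow> blinfun_apply P x = x"
proof -
  have "\<exists>k\<in>K. \<forall>z\<in>K. cinner z (x - k) = 0" for x
    using orthogonal_decomposition[OF K] by metis
  then obtain p where pK: "\<And>x. p x \<in> K" and p: "\<And>x z. z \<in> K \<Longrightarrow> cinner z (x - p x) = 0"
    by metis
  note sub = closed_csubspaceD(3-6)[OF K]
  \<comment> \<open>Additivity, homogeneity and \<open>p x = x\<close> on \<open>K\<close> all
    follow by testing the expected value as a candidate here.\<close>
  have uniq: "p x = k" if k: "k \<in> K" and orth: "\<And>z. z \<in> K \<Longrightarrow> cinner z (x - k) = 0" for x k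
  proof -
    have m: "p x - k \<in> K" by (intro sub pK k)
    have "cinner (p x - k) (p x - k) = cinner (p x - k) (x - k) - cinner (p x - k) (x - p x)"
      by (simp flip: cinner_diff_right)
    then show ?thesis using p[OF m] orth[OF m] by simp
  qed
  have add: "p (x + y) = p x + p y" for x y
  proof (rule uniq)
    fix z assume "z \<in> K"
    then have "cinner z ((x - p x) + (y - p y)) = 0" using p by (simp add: cinner_add_right)
    then show "cinner z (x + y - (p x + p y)) = 0" by (simp add: algebra_simps)
  qed (intro sub pK)
  have scale: "p (c *\<^sub>C x) = c *\<^sub>C p x" for c x
  proof (rule uniq)
    fix z assume "z \<in> K"
    then show "cinner z (c *\<^sub>C x - c *\<^sub>C p x) = 0"
      using p[of z x] by (simp add: cinner_diff_right cinner_scaleC_right)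
  qed (intro sub pK)
  have "bounded_linear p"
  proof (rule bounded_linear_intro[of _ 1])
    show "norm (p x) \<le> norm x * 1" for x
      using norm_add_power2[of "p x" "x - p x"] p[OF pK, of x x] by (simp add: power2_le_imp_le)
  qed (simp_all add: add scale flip: scaleC_of_real)
  then have app: "blinfun_apply (Blinfun p) = p" by (rule bounded_linear_Blinfun_apply)
  have p_id: "p x = x" if "x \<in> K" for x using that by (intro uniq) simp_all
  have "projection (Blinfun p)"
  proof (rule projectionI)
    show "Blinfun p \<in> bounded_ops" by (simp add: bounded_ops_def app scale)
    show "cinner (blinfun_apply (Blinfun p) x) y = cinner x (blinfun_apply (Blinfun p) y)" for x y
    proof -
      \<comment> \<open>Both sides of the symmetry claim equal <p x, p y>, since residuals are
        orthogonal to \<open>K\<close>.\<close>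
      have "cinner (p x) y = cinner (p x) (p y)"
        using p[OF pK, of x y] by (simp add: cinner_diff_right)
      also have "\<dots> = cinner x (p y)"
        using p[OF pK, of y x] cinner_commute[of "p x" "p y"] cinner_commute[of x "p y"]
        by (simp add: cinner_diff_right)
      finally show ?thesis by (simp add: app)
    qed
  qed (simp add: app p_id pK)
  then show thesis using pK p_id by (intro that[of "Blinfun p"]) (auto simp: app)
qed

section \<open>Joins of projections\<close>

lemma blinfun_compose_assoc: "(A o\<^sub>L B) o\<^sub>L C = A o\<^sub>L (B o\<^sub>L C)"
  by (rule blinfun_eqI) simp

text \<open>Passing to adjoints exchanges the factors, and both projections are
  self-adjoint.\<close>

lemma proj_le_commute:
  assumes "projection P" and "projection Q"
  shows "proj_le P Q \<longleftrightarrow> P o\<^sub>L Q = P"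
proof
  assume "proj_le P Q"
  then have QP: "blinfun_apply Q (blinfun_apply P x) = blinfun_apply P x" for x
    by (metis proj_le_def blinfun_apply_blinfun_compose)
  show "P o\<^sub>L Q = P"
  proof (rule blinfun_eqI[OF cinner_eqI])
    show "cinner z (blinfun_apply (P o\<^sub>L Q) x) = cinner z (blinfun_apply P x)" for x z
      by (simp add: QP flip: projectionD(3)[OF assms(1)] projectionD(3)[OF assms(2)])
  qed
next
  assume "P o\<^sub>L Q = P"
  then have PQ: "blinfun_apply P (blinfun_apply Q x) = blinfun_apply P x" for x
    by (metis blinfun_apply_blinfun_compose)
  have "Q o\<^sub>L P = P"
  proof (rule blinfun_eqI[OF cinner_eqI])
    show "cinner z (blinfun_apply (Q o\<^sub>L P) x) = cinner z (blinfun_apply P x)" for x z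
      by (simp add: PQ flip: projectionD(3)[OF assms(1)] projectionD(3)[OF assms(2)])
  qed
  then show "proj_le P Q" by (simp add: proj_le_def)
qed

text \<open>The join is \<open>id_blinfun - P\<close>, where \<open>P\<close> projects onto the
  common kernel \<open>Z\<close> of the members of \<open>S\<close>. This shows that the description
  defining \<open>proj_Sup\<close> denotes, and the third conclusion retains the kernel information
  used for approximating joins.\<close>

lemma proj_Sup:
  assumes S: "\<And>Q. Q \<in> S \<Longrightarrow> projection Q"
  shows projection_proj_Sup: "projection (proj_Sup S)"
    and proj_Sup_upper: "\<And>Q. Q \<in> S \<Longrightarrow> proj_le Q (proj_Sup S)"
    and proj_Sup_kernel: "\<And>w. (\<And>Q. Q \<in> S \<Longrightarrow> blinfun_apply Q w = 0) \<Longrightarrow> blinfun_apply (proj_Sup S) w = 0"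
proof -
  define Z where "Z = {w. \<forall>Q\<in>S. blinfun_apply Q w = 0}"
  have "closed {w. blinfun_apply Q w = 0}" for Q :: "'a \<Rightarrow>\<^sub>L 'a"
    by (intro closed_Collect_eq continuous_intros)
  moreover have "Z = (\<Inter>Q\<in>S. {w. blinfun_apply Q w = 0})" by (auto simp: Z_def)
  ultimately have "closed Z" by auto
  moreover have "c *\<^sub>C w \<in> Z" if "w \<in> Z" for c w
    using that projectionD(1)[OF S] by (simp add: Z_def bounded_ops_def)
  ultimately have "closed_csubspace Z"
    by (auto simp: closed_csubspace_def Z_def blinfun.add_right)
  then obtain P where P: "projection P" and PZ: "range (blinfun_apply P) \<subseteq> Z"
    and fixP: "\<And>x. x \<in> Z \<Longrightarrow> blinfun_apply P x = x"
    using projection_onto by blast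
  define J where "J = id_blinfun - P"
  have J: "projection J" unfolding J_def by (rule projection_id_minus[OF P])
  have upper: "proj_le Q J" if Q: "Q \<in> S" for Q
    unfolding proj_le_commute[OF S[OF Q] J]
    using subsetD[OF PZ rangeI] Q
    by (intro blinfun_eqI) (simp add: J_def Z_def blinfun.diff_left blinfun.diff_right)
  \<comment> \<open>For an upper bound \<open>R\<close>, every \<open>x - R x\<close> is killed by
    all of \<open>S\<close>, hence lies in \<open>Z\<close> and is killed by
    \<open>J\<close>.\<close>
  have least: "proj_le J R" if R: "projection R" and le: "\<And>Q. Q \<in> S \<Longrightarrow> proj_le Q R" for R
    unfolding proj_le_commute[OF J R]
  proof (rule blinfun_eqI)
    fix x
    have "x - blinfun_apply R x \<in> Z"
    proof -
      have "blinfun_apply Q (blinfun_apply R x) = blinfun_apply Q x" if "Q \<in> S" for Q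
        using le[OF that] unfolding proj_le_commute[OF S[OF that] R]
        by (metis blinfun_apply_blinfun_compose)
      then show ?thesis by (simp add: Z_def blinfun.diff_right)
    qed
    from fixP[OF this] show "blinfun_apply (J o\<^sub>L R) x = blinfun_apply J x"
      by (simp add: J_def blinfun.diff_left blinfun.diff_right algebra_simps)
  qed
  have "proj_Sup S = J"
    unfolding proj_Sup_def
  proof (rule the_equality)
    fix P' assume P': "projection P' \<and> (\<forall>Q\<in>S. proj_le Q P') \<and>
      (\<forall>R. projection R \<and> (\<forall>Q\<in>S. proj_le Q R) \<longrightarrow> proj_le P' R)"
    then have "proj_le P' J" "proj_le J P'" by (blast intro: J upper least)+
    \<comment> \<open>Antisymmetry: the composite of \<open>P'\<close> with \<open>J\<close> equals
      either factor.\<close>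
    then show "P' = J" using P' J proj_le_commute[of P' J] by (simp add: proj_le_def)
  qed (blast intro: J upper least)
  then show "projection (proj_Sup S)" "\<And>Q. Q \<in> S \<Longrightarrow> proj_le Q (proj_Sup S)"
    by (simp_all only: J upper)
  show "blinfun_apply (proj_Sup S) w = 0" if "\<And>Q. Q \<in> S \<Longrightarrow> blinfun_apply Q w = 0" for w
    using fixP[of w] that \<open>proj_Sup S = J\<close> by (simp add: J_def Z_def blinfun.diff_left)
qed

section \<open>Weak*-closed subspaces and joins\<close>

lemma amplify_diff: "amplify (S - T) = amplify S - amplify T"
  and amplify_add: "amplify (S + T) = amplify S + amplify T"
  by (intro blinfun_eqI l2_eqI;
      simp add: coord_amplify coord_simps blinfun.diff_left blinfun.add_left)+

lemma amplify_scale_op: "blinfun_apply (amplify (scale_op c T)) x = c *\<^sub>C blinfun_apply (amplify T) x"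
  by (rule l2_eqI) (simp add: coord_amplify scaleC_l2.rep_eq scale_op.rep_eq)

lemma cinner_amplify:
  assumes "\<And>x y. cinner (blinfun_apply S x) y = cinner x (blinfun_apply T y)"
  shows "cinner (blinfun_apply (amplify S) x) y = cinner x (blinfun_apply (amplify T) y)"
  by (simp add: cinner_l2_def coord_amplify assms)

text \<open>\<open>z\<close> carries \<open>x\<close> in its even coordinates and \<open>y\<close>
  in its odd ones. Amplified operators act coordinatewise, so one \<open>z\<close> serves every
  \<open>T\<close>.\<close>

lemma interleave_l2:
  fixes x y :: "'h::chilbert_space l2"
  obtains z where "\<And>T. (norm (blinfun_apply (amplify T) z))\<^sup>2 =
    (norm (blinfun_apply (amplify T) x))\<^sup>2 + (norm (blinfun_apply (amplify T) y))\<^sup>2"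
proof -
  define f where "f n = (if even n then coord x (n div 2) else coord y ((n - 1) div 2))" for n
  have if_sums: "(\<lambda>n. (norm (T (f n)))\<^sup>2) sums
      ((\<Sum>n. (norm (T (coord x n)))\<^sup>2) + (\<Sum>n. (norm (T (coord y n)))\<^sup>2))"
    if "summable (\<lambda>n. (norm (T (coord x n)))\<^sup>2)" "summable (\<lambda>n. (norm (T (coord y n)))\<^sup>2)"
    for T :: "'h \<Rightarrow> 'h"
  proof -
    have "(\<lambda>n. (norm (T (f n)))\<^sup>2) = (\<lambda>n. if even n then (norm (T (coord x (n div 2))))\<^sup>2
        else (norm (T (coord y ((n - 1) div 2))))\<^sup>2)"
      by (simp add: f_def fun_eq_iff)
    then show ?thesis using sums_if[OF summable_sums[OF that(2)] summable_sums[OF that(1)]]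
      by (simp add: add.commute)
  qed
  have "summable (\<lambda>n. (norm (f n))\<^sup>2)"
    using if_sums[of "\<lambda>x. x"] summable_coord by (blast intro: sums_summable)
  then have f: "coord (Abs_l2 f) = f" by (simp add: Abs_l2_inverse)
  have "(norm (blinfun_apply (amplify T) (Abs_l2 f)))\<^sup>2 =
      (norm (blinfun_apply (amplify T) x))\<^sup>2 + (norm (blinfun_apply (amplify T) y))\<^sup>2" for T
    using if_sums[of "blinfun_apply T"] summable_coord[of "blinfun_apply (amplify T) x"]
      summable_coord[of "blinfun_apply (amplify T) y"]
    by (simp add: norm_l2_power2 coord_amplify f sums_iff)
  then show thesis by (rule that)
qed

text \<open>The weak* topology is coarser than the ultrastrong one. Interleaving two sequences
  makes a single vector of \<open>'h l2\<close> control both members of a finite intersection.\<close>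

lemma weakstar_open_ultrastrong:
  assumes "openin weakstar U" and "J \<in> U"
  shows "\<exists>y. \<exists>e>0. \<forall>T\<in>bounded_ops. norm (blinfun_apply (amplify (T - J)) y) < e \<longrightarrow> T \<in> U"
proof -
  define G :: "('a \<Rightarrow>\<^sub>L 'a) set set" where "G =
    {{T \<in> bounded_ops. (\<Sum>n. cinner (coord x n) (blinfun_apply T (coord y n))) \<in> U} | x y U. open U}"
  have "generate_topology_on G U"
    using assms(1) unfolding weakstar_def G_def[symmetric] openin_topology_generated_by_iff .
  then show ?thesis using assms(2)
  proof induction
    case (Int a b)
    then obtain y e z d where y: "e > 0"
        "\<And>T. T \<in> bounded_ops \<Longrightarrow> norm (blinfun_apply (amplify (T - J)) y) < e \<Longrightarrow> T \<in> a"
      and z: "d > 0"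
        "\<And>T. T \<in> bounded_ops \<Longrightarrow> norm (blinfun_apply (amplify (T - J)) z) < d \<Longrightarrow> T \<in> b"
      by (metis IntE)
    obtain v where v: "\<And>T. (norm (blinfun_apply (amplify T) v))\<^sup>2 =
      (norm (blinfun_apply (amplify T) y))\<^sup>2 + (norm (blinfun_apply (amplify T) z))\<^sup>2"
      using interleave_l2[of y z] by blast
    have le: "norm (blinfun_apply (amplify T) y) \<le> norm (blinfun_apply (amplify T) v)"
      "norm (blinfun_apply (amplify T) z) \<le> norm (blinfun_apply (amplify T) v)" for T
      by (rule power2_le_imp_le; simp add: v)+
    show ?case
    proof (intro exI[of _ v] exI[of _ "min e d"] conjI ballI impI)
      fix T assume T: "T \<in> bounded_ops" "norm (blinfun_apply (amplify (T - J)) v) < min e d"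
      then show "T \<in> a \<inter> b" using y(2)[OF T(1)] z(2)[OF T(1)] le[of "T - J"] by simp
    qed (use y z in simp)
  next
    case (UN K)
    then show ?case by (meson UnionE UnionI)
  next
    case (Basis s)
    \<comment> \<open>The series in a generator of the topology is the inner product of
      \<open>x\<close> with the amplified operator applied to \<open>y\<close>, so Cauchy-Schwarz is
      available.\<close>
    then obtain x y U where s: "s = {T \<in> bounded_ops. cinner x (blinfun_apply (amplify T) y) \<in> U}"
      and "open U" unfolding G_def cinner_l2_def coord_amplify by blast
    then obtain e where e: "e > 0" "ball (cinner x (blinfun_apply (amplify J) y)) e \<subseteq> U"
      using Basis(2) open_contains_ball by blast
    show ?case
    proof (intro exI[of _ y] exI[of _ "e / (norm x + 1)"] conjI ballI impI)
      \<comment> \<open>Adding 1 keeps the radius meaningful and positive when \<open>x\<close> is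
        zero.\<close>
      have pos: "norm x + 1 > 0" using norm_ge_zero[of x] by linarith
      then show "e / (norm x + 1) > 0" using e by simp
      fix T assume T: "T \<in> bounded_ops"
        and less: "norm (blinfun_apply (amplify (T - J)) y) < e / (norm x + 1)"
      have "dist (cinner x (blinfun_apply (amplify J) y)) (cinner x (blinfun_apply (amplify T) y))
          = cmod (cinner x (blinfun_apply (amplify (T - J)) y))"
        by (simp add: dist_norm amplify_diff blinfun.diff_left cinner_diff_right norm_minus_commute)
      also have "\<dots> \<le> norm x * norm (blinfun_apply (amplify (T - J)) y)" by (rule norm_cinner_le)
      also have "\<dots> \<le> (norm x + 1) * norm (blinfun_apply (amplify (T - J)) y)"
        by (simp add: mult_right_mono)
      also have "\<dots> < e" using less pos by (simp add: pos_less_divide_eq mult.commute)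
      finally show "T \<in> s" using T e(2) by (auto simp: s)
    qed
  qed simp
qed

lemma topspace_weakstar: "topspace weakstar = bounded_ops"
proof
  show "topspace weakstar \<subseteq> (bounded_ops :: ('a \<Rightarrow>\<^sub>L 'a) set)"
    unfolding weakstar_def topology_generated_by_topspace by blast
  show "bounded_ops \<subseteq> topspace (weakstar :: ('a \<Rightarrow>\<^sub>L 'a) topology)"
    unfolding weakstar_def topology_generated_by_topspace by (blast intro: open_UNIV UNIV_I)
qed

section \<open>Joins inside weak*-closed subspaces\<close>

lemma closed_csubspace_closure:
  assumes "0 \<in> L" and add: "\<And>x y. x \<in> L \<Longrightarrow> y \<in> L \<Longrightarrow> x + y \<in> L"
    and scale: "\<And>c x. x \<in> L \<Longrightarrow> c *\<^sub>C x \<in> L"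
  shows "closed_csubspace (closure L)"
  unfolding closed_csubspace_def
proof (intro conjI ballI allI)
  show "0 \<in> closure L" using assms(1) closure_subset by blast
  show "x + y \<in> closure L" if "x \<in> closure L" "y \<in> closure L" for x y
  proof -
    from that obtain X Y where "\<And>n. X n \<in> L" "X \<longlonglongrightarrow> x" "\<And>n. Y n \<in> L" "Y \<longlonglongrightarrow> y"
      unfolding closure_sequential by blast
    then show ?thesis unfolding closure_sequential
      by (intro exI[of _ "\<lambda>n. X n + Y n"]) (simp add: add tendsto_add)
  qed
  show "c *\<^sub>C x \<in> closure L" if "x \<in> closure L" for c x
  proof -
    from that obtain X where "\<And>n. X n \<in> L" "X \<longlonglongrightarrow> x"
      unfolding closure_sequential by blast
    then show ?thesis unfolding closure_sequential
      by (intro exI[of _ "\<lambda>n. c *\<^sub>C X n"])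
        (simp add: scale bounded_linear.tendsto[OF bounded_linear_scaleC])
  qed
qed simp

text \<open>The join \<open>J\<close> of \<open>S\<close> is an ultrastrong limit of operators in \<open>A\<close>: for a vector \<open>y\<close> of
  the amplification, split \<open>y = k + w\<close> with \<open>k\<close> in the closure of \<open>A y\<close> and \<open>w\<close> orthogonal to
  it. Every projection in \<open>S\<close> kills \<open>w\<close>, hence so does \<open>J\<close>, and \<open>J y = J k = k\<close>.\<close>

lemma proj_Sup_mem:
  assumes A: "op_subspace A" and closed: "closedin weakstar A"
    and SA: "S \<subseteq> A" and S: "\<And>Q. Q \<in> S \<Longrightarrow> projection Q"
    and mult: "\<And>Q T. Q \<in> S \<Longrightarrow> T \<in> A \<Longrightarrow> Q o\<^sub>L T \<in> A"
  shows "proj_Sup S \<in> A"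
proof -
  define J where "J = proj_Sup S"
  \<comment> \<open>Restricting \<open>A\<close> to operators whose range lies in that of
    \<open>J\<close> ensures that \<open>J\<close> fixes the closure of the vectors
    \<open>T y\<close>; this gives \<open>J k = k\<close>. The set still contains \<open>S\<close>
    and is stable under left multiplication by its members.\<close>
  define B where "B = {T \<in> A. J o\<^sub>L T = T}"
  have JQ: "J o\<^sub>L Q = Q" if "Q \<in> S" for Q
    using proj_Sup_upper[OF S that] by (simp add: J_def proj_le_def)
  have SB: "S \<subseteq> B" using SA JQ by (auto simp: B_def)
  have J: "projection J" unfolding J_def by (rule projection_proj_Sup[OF S])
  have B0: "0 \<in> B" and Badd: "T \<in> B \<Longrightarrow> T' \<in> B \<Longrightarrow> T + T' \<in> B"
    and Bscale: "T \<in> B \<Longrightarrow> scale_op c T \<in> B" and Bmult: "Q \<in> S \<Longrightarrow> T \<in> B \<Longrightarrow> Q o\<^sub>L T \<in> B"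
    for T T' Q c
  proof -
    show "0 \<in> B" using A by (simp add: B_def op_subspace_def)
    show "T \<in> B \<Longrightarrow> T' \<in> B \<Longrightarrow> T + T' \<in> B"
      using A by (simp add: B_def op_subspace_def bounded_bilinear.add_right[OF bounded_bilinear_blinfun_compose])
    show "scale_op c T \<in> B" if "T \<in> B"
    proof -
      have "J o\<^sub>L scale_op c T = scale_op c (J o\<^sub>L T)"
        using projectionD(1)[OF J]
        by (intro blinfun_eqI) (simp add: bounded_ops_def scale_op.rep_eq)
      then show ?thesis using A that by (simp add: B_def op_subspace_def)
    qed
    show "Q o\<^sub>L T \<in> B" if "Q \<in> S" "T \<in> B"
      using that mult JQ[OF that(1)] by (simp add: B_def flip: blinfun_compose_assoc)
  qed
  have dense: "\<exists>T\<in>B. norm (blinfun_apply (amplify (T - J)) y) < e" if "e > 0" for y e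
  proof -
    define L where "L = (\<lambda>T. blinfun_apply (amplify T) y) ` B"
    have K: "closed_csubspace (closure L)"
    proof (rule closed_csubspace_closure)
      have "blinfun_apply (amplify 0) y = 0" using amplify_eq_0_iff[of "0 :: 'a \<Rightarrow>\<^sub>L 'a"] by simp
      then show "0 \<in> L" using B0 unfolding L_def by (metis imageI)
      show "u + v \<in> L" if "u \<in> L" "v \<in> L" for u v
        using that Badd unfolding L_def by (force simp: amplify_add blinfun.add_left)
      show "c *\<^sub>C u \<in> L" if "u \<in> L" for c u
        using that Bscale unfolding L_def by (force simp flip: amplify_scale_op)
    qed
    then obtain k where k: "k \<in> closure L" and orth: "\<And>z. z \<in> closure L \<Longrightarrow> cinner z (y - k) = 0"
      using orthogonal_decomposition[of "closure L" y] by metis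
    have inv: "blinfun_apply (amplify Q) v \<in> closure L" if "Q \<in> S" "v \<in> closure L" for Q v
    proof -
      have "blinfun_apply (amplify Q) ` closure L \<subseteq> closure L"
      proof (rule image_closure_subset)
        show "blinfun_apply (amplify Q) ` L \<subseteq> closure L"
          using Bmult[OF that(1)] closure_subset[of L]
          by (force simp: L_def amplify_compose)
      qed (auto intro: continuous_intros)
      with that show ?thesis by blast
    qed
    \<comment> \<open>Since \<open>Q y\<close> and \<open>Q k\<close> lie in the closure, so do
      \<open>v\<close> and then \<open>Q v\<close>. Thus \<open>Q v\<close> is orthogonal to
      \<open>y - k\<close>, and moving \<open>Q\<close> across the inner product turns this into <v,
      v> = 0.\<close>
    have kill: "blinfun_apply (amplify Q) (y - k) = 0" if Q: "Q \<in> S" for Q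
    proof -
      define v where "v = blinfun_apply (amplify Q) (y - k)"
      have "blinfun_apply (amplify Q) y \<in> closure L"
        using Q SB closure_subset[of L] by (auto simp: L_def)
      then have "v \<in> closure L"
        using inv[OF Q k] closed_csubspaceD(5)[OF K] by (simp add: v_def blinfun.diff_right)
      then have "cinner (blinfun_apply (amplify Q) v) (y - k) = 0" by (intro orth inv Q)
      then have "cinner v v = 0"
        using cinner_amplify[of Q Q v "y - k"] projectionD(3)[OF S[OF Q]] by (simp add: v_def)
      then show ?thesis by (simp add: v_def)
    qed
    have "blinfun_apply (amplify J) (y - k) = 0"
    proof (rule l2_eqI)
      fix n
      \<comment> \<open>The kernel property of the join concerns vectors of the original space,
        hence the passage to coordinates.\<close>
      have "blinfun_apply Q (coord (y - k) n) = 0" if "Q \<in> S" for Q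
        using kill[OF that] by (metis coord_amplify zero_l2.rep_eq)
      then show "coord (blinfun_apply (amplify J) (y - k)) n = coord 0 n"
        unfolding coord_amplify zero_l2.rep_eq J_def by (intro proj_Sup_kernel S)
    qed
    moreover have "blinfun_apply (amplify J) k = k"
    proof -
      have "closed {v. blinfun_apply (amplify J) v = v}"
        by (intro closed_Collect_eq continuous_intros)
      moreover have "L \<subseteq> {v. blinfun_apply (amplify J) v = v}"
        by (auto simp: L_def B_def simp flip: blinfun_apply_blinfun_compose amplify_compose)
      ultimately have "closure L \<subseteq> {v. blinfun_apply (amplify J) v = v}" by (rule closure_minimal[rotated])
      with k show ?thesis by blast
    qed
    ultimately have "blinfun_apply (amplify J) y \<in> closure L" using k by (simp add: blinfun.diff_right)
    then show ?thesis
      using \<open>e > 0\<close> unfolding closure_approachable L_def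
      by (auto simp: dist_norm amplify_diff blinfun.diff_left)
  qed
  have "J \<in> weakstar closure_of B"
    unfolding in_closure_of topspace_weakstar
  proof (intro conjI allI impI)
    fix U assume "J \<in> U \<and> openin weakstar U"
    then obtain y e where "e > 0"
      and "\<forall>T\<in>bounded_ops. norm (blinfun_apply (amplify (T - J)) y) < e \<longrightarrow> T \<in> U"
      using weakstar_open_ultrastrong by metis
    moreover obtain T where "T \<in> B" "norm (blinfun_apply (amplify (T - J)) y) < e"
      using dense[OF \<open>e > 0\<close>] by blast
    moreover have "T \<in> bounded_ops" using \<open>T \<in> B\<close> A by (auto simp: B_def op_subspace_def)
    ultimately show "\<exists>T. T \<in> B \<and> T \<in> U" by blast
  qed (rule projectionD(1)[OF J])
  also have "weakstar closure_of B \<subseteq> A"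
    using closed by (intro closure_of_minimal) (auto simp: B_def)
  finally show ?thesis by (simp add: J_def)
qed

text \<open>Sequences supported at index 0 reduce the series of a generator to a single term, so
  weak* open sets include those of the weak operator topology.\<close>

lemma openin_weakstar_cinner:
  assumes "open U"
  shows "openin weakstar {T \<in> bounded_ops. cinner x (blinfun_apply T y) \<in> U}"
proof -
  define single where "single v = Abs_l2 (\<lambda>n::nat. if n = 0 then v else 0)" for v :: 'a
  have single: "coord (single v) n = (if n = 0 then v else 0)" for v n
  proof -
    have "summable (\<lambda>n. (norm (if n = 0 then v else 0))\<^sup>2)" by (rule summable_finite[of "{0}"]) auto
    then show ?thesis by (simp add: single_def Abs_l2_inverse)
  qed
  have "(\<Sum>n. cinner (coord (single x) n) (blinfun_apply T (coord (single y) n))) =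
      cinner x (blinfun_apply T y)" for T
    by (subst suminf_finite[of "{0}"]) (simp_all add: single)
  then show ?thesis
    using assms unfolding weakstar_def
    by (intro topology_generated_by_Basis CollectI exI[of _ "single x"] exI[of _ "single y"] exI[of _ U])
      simp
qed

text \<open>\<open>T\<close> has its range in that of \<open>E\<close> exactly when all vectors
  \<open>E x - x\<close> are orthogonal to the range of \<open>T\<close>. This is an intersection of
  zero sets of weak* continuous functionals.\<close>

lemma closedin_weakstar_range:
  assumes E: "projection E"
  shows "closedin weakstar {T \<in> bounded_ops. E o\<^sub>L T = T}"
proof -
  have eq: "E o\<^sub>L T = T \<longleftrightarrow> (\<forall>x y. cinner (blinfun_apply E x - x) (blinfun_apply T y) = 0)" for T
  proof -
    have "cinner (blinfun_apply E x - x) (blinfun_apply T y) =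
        cinner x (blinfun_apply (E o\<^sub>L T) y - blinfun_apply T y)" for x y
      by (simp add: cinner_diff_left cinner_diff_right projectionD(3)[OF E])
    then show ?thesis
      by (metis blinfun_eqI cinner_eqI cinner_zero_right eq_iff_diff_eq_0)
  qed
  have "closedin weakstar {T \<in> bounded_ops. cinner x (blinfun_apply T y) = 0}" for x y :: 'a
  proof -
    have "bounded_ops - {T \<in> bounded_ops. cinner x (blinfun_apply T y) = 0} =
        {T \<in> bounded_ops. cinner x (blinfun_apply T y) \<in> - {0}}" by blast
    moreover have "openin weakstar {T \<in> bounded_ops. cinner x (blinfun_apply T y) \<in> - {0}}"
      by (rule openin_weakstar_cinner) auto
    ultimately show ?thesis by (auto simp: closedin_def topspace_weakstar)
  qed
  then have "closedin weakstar (\<Inter>x. \<Inter>y.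
      {T \<in> bounded_ops. cinner (blinfun_apply E x - x) (blinfun_apply T y) = 0})"
    by (intro closedin_Inter) auto
  moreover have "(\<Inter>x. \<Inter>y. {T \<in> bounded_ops. cinner (blinfun_apply E x - x) (blinfun_apply T y) = 0})
      = {T \<in> bounded_ops. E o\<^sub>L T = T}" by (simp add: eq set_eq_iff)
  ultimately show ?thesis by simp
qed

section \<open>Quantum functions and coarse embeddings\<close>

lemma scale_op_zero: "scale_op 0 T = 0"
  by (rule blinfun_eqI) (simp add: scale_op.rep_eq scaleC_of_real[of 0, simplified])

lemma scale_op_minus1: "scale_op (-1) T = - T"
  by (intro blinfun_eqI) (simp add: scale_op.rep_eq scaleC_minus1 blinfun.minus_left)

lemma quantum_function_zero:
  assumes "von_neumann_algebra M" and "quantum_function M N \<phi>"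
  shows "\<phi> 0 = 0"
proof -
  have "0 \<in> M" using assms(1) by (simp add: von_neumann_algebra_def op_subspace_def)
  then have "\<phi> (scale_op 0 0) = scale_op 0 (\<phi> 0)" using assms(2) by (simp add: quantum_function_def)
  then show ?thesis by (simp add: scale_op_zero)
qed

lemma quantum_function_projs:
  assumes "quantum_function M N \<phi>" and "N \<subseteq> bounded_ops" and "P \<in> projs M"
  shows "\<phi> P \<in> projs N"
proof -
  have "P \<in> M" "P o\<^sub>L P = P" "adj P = P" using assms(3) by (auto simp: projs_def projection_def)
  with assms(1,2) show ?thesis
    unfolding projs_def projection_def quantum_function_def mem_Collect_eq
    by (metis image_subset_iff subsetD)
qed

text \<open>Both conclusions are instances of \<open>proj_Sup_mem\<close>: the first for the
  subspace \<open>M\<close> itself, the second for the right ideal \<open>A\<close> of those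
  \<open>T\<close> in \<open>M\<close> whose image under \<phi> has its range in that of
  \<open>E\<close>.\<close>

lemma quantum_function_proj_Sup:
  assumes M: "von_neumann_algebra M" and N: "N \<subseteq> bounded_ops" and \<phi>: "quantum_function M N \<phi>"
    and S: "S \<subseteq> projs M"
  shows proj_Sup_projs: "proj_Sup S \<in> projs M"
    and quantum_function_proj_Sup_le:
      "\<And>E. projection E \<Longrightarrow> (\<And>Q. Q \<in> S \<Longrightarrow> proj_le (\<phi> Q) E) \<Longrightarrow> proj_le (\<phi> (proj_Sup S)) E"
proof -
  have Sproj: "projection Q" and SM: "Q \<in> M" if "Q \<in> S" for Q
    using that S by (auto simp: projs_def)
  have sub: "op_subspace M" and closed: "closedin weakstar M"
    and mult: "\<And>T T'. T \<in> M \<Longrightarrow> T' \<in> M \<Longrightarrow> T o\<^sub>L T' \<in> M"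
    using M by (auto simp: von_neumann_algebra_def)
  have "proj_Sup S \<in> M"
    by (rule proj_Sup_mem[OF sub closed]) (use SM Sproj mult in auto)
  then show "proj_Sup S \<in> projs M"
    using projection_proj_Sup[OF Sproj] by (simp add: projs_def)
  fix E assume E: "projection E" and le: "\<And>Q. Q \<in> S \<Longrightarrow> proj_le (\<phi> Q) E"
  define A where "A = {T \<in> M. E o\<^sub>L \<phi> T = \<phi> T}"
  have MN: "\<phi> T \<in> bounded_ops" "\<phi> T \<in> N" if "T \<in> M" for T
    using that \<phi> N by (auto simp: quantum_function_def)
  have topM: "topspace weakstar \<inter> M = M"
    using sub by (auto simp: topspace_weakstar op_subspace_def)
  have "proj_Sup S \<in> A"
  proof (rule proj_Sup_mem)
    show "op_subspace A"
      unfolding op_subspace_def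
    proof (intro conjI ballI allI)
      show "A \<subseteq> bounded_ops" "0 \<in> A"
        using sub quantum_function_zero[OF M \<phi>] by (auto simp: A_def op_subspace_def)
      show "T + T' \<in> A" if "T \<in> A" "T' \<in> A" for T T'
        using that sub \<phi>
        by (simp add: A_def op_subspace_def quantum_function_def bounded_bilinear.add_right[OF bounded_bilinear_blinfun_compose])
      show "scale_op c T \<in> A" if "T \<in> A" for c T
      proof -
        have "E o\<^sub>L scale_op c (\<phi> T) = scale_op c (E o\<^sub>L \<phi> T)"
          using projectionD(1)[OF E]
          by (intro blinfun_eqI) (simp add: bounded_ops_def scale_op.rep_eq)
        then show ?thesis
          using that sub \<phi> by (simp add: A_def op_subspace_def quantum_function_def)
      qed
    qed
    have "continuous_map (subtopology weakstar M) weakstar \<phi>"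
      using \<phi> by (auto simp: quantum_function_def continuous_map_in_subtopology)
    \<comment> \<open>The preimage is closed relative to \<open>M\<close> only; weak* closedness of
      \<open>M\<close> then makes it closed in the full topology.\<close>
    from closedin_continuous_map_preimage[OF this closedin_weakstar_range[OF E]]
    have "closedin (subtopology weakstar M) {T \<in> M. \<phi> T \<in> {T \<in> bounded_ops. E o\<^sub>L T = T}}"
      by (simp add: topM)
    moreover have "{T \<in> M. \<phi> T \<in> {T \<in> bounded_ops. E o\<^sub>L T = T}} = A"
      using MN by (auto simp: A_def)
    ultimately show "closedin weakstar A" using closedin_trans_full closed by metis
    show "S \<subseteq> A" using le SM by (auto simp: A_def proj_le_def)
    show "Q o\<^sub>L T \<in> A" if "Q \<in> S" "T \<in> A" for Q T
    proof -
      have "E o\<^sub>L (\<phi> Q o\<^sub>L \<phi> T) = \<phi> Q o\<^sub>L \<phi> T"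
        using le[OF that(1)] by (simp add: proj_le_def flip: blinfun_compose_assoc)
      then show ?thesis
        using that SM[OF that(1)] mult \<phi> by (simp add: A_def quantum_function_def)
    qed
  qed (rule Sproj)
  then show "proj_le (\<phi> (proj_Sup S)) E" by (simp add: A_def proj_le_def)
qed

lemma quantum_function_complement:
  assumes M: "von_neumann_algebra M" and \<phi>: "quantum_function M N \<phi>" and T: "T \<in> M"
  shows "id_blinfun - T \<in> M" and "\<phi> (id_blinfun - T) = id_blinfun - \<phi> T"
proof -
  have id: "id_blinfun \<in> M" and neg: "scale_op (-1) T \<in> M"
    and add: "\<And>S T. S \<in> M \<Longrightarrow> T \<in> M \<Longrightarrow> S + T \<in> M"
    using M T by (auto simp: von_neumann_algebra_def op_subspace_def)
  \<comment> \<open>Subspaces and \<phi> come with rules for sums and scalar multiples, so the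
    difference is expressed through these.\<close>
  have eq: "id_blinfun - T = id_blinfun + scale_op (-1) T"
    by (simp add: scale_op_minus1)
  show "id_blinfun - T \<in> M" unfolding eq by (intro add id neg)
  have "\<phi> (id_blinfun + scale_op (-1) T) = id_blinfun + scale_op (-1) (\<phi> T)"
    using \<phi> T id neg unfolding quantum_function_def by metis
  then show "\<phi> (id_blinfun - T) = id_blinfun - \<phi> T"
    by (simp add: scale_op_minus1)
qed

text \<open>The join of the projections far from \<open>P\<close> is mapped below the join of those
  far from \<open>\<phi> P\<close>; complements reverse the order. The resulting inequality is
  recorded as absorption on either side, ready for use inside products.\<close>

lemma nbhd_quantum_function:
  assumes M: "von_neumann_algebra M" and N: "von_neumann_algebra N" and \<phi>: "quantum_function M N \<phi>"
    and dist: "\<And>Q. Q \<in> projs M \<Longrightarrow> mdist V P Q \<ge> ennreal s \<Longrightarrow> mdist W (\<phi> P) (\<phi> Q) \<ge> ennreal r"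
  shows "nbhd M V s P \<in> M"
    and "\<phi> (nbhd M V s P) o\<^sub>L nbhd N W r (\<phi> P) = nbhd N W r (\<phi> P)"
    and "nbhd N W r (\<phi> P) o\<^sub>L \<phi> (nbhd M V s P) = nbhd N W r (\<phi> P)"
proof -
  define S where "S = {Q \<in> projs M. mdist V P Q \<ge> ennreal s}"
  define S' where "S' = {Q \<in> projs N. mdist W (\<phi> P) Q \<ge> ennreal r}"
  have NB: "N \<subseteq> bounded_ops" using N by (simp add: von_neumann_algebra_def op_subspace_def)
  note image = quantum_function_projs[OF \<phi> NB]
  have S: "S \<subseteq> projs M" by (auto simp: S_def)
  have S': "projection Q" if "Q \<in> S'" for Q using that by (simp add: S'_def projs_def)
  have J': "projection (proj_Sup S')" by (rule projection_proj_Sup[OF S'])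
  have J: "proj_Sup S \<in> projs M" by (rule proj_Sup_projs[OF M NB \<phi> S])
  then have \<phi>J: "projection (\<phi> (proj_Sup S))" using image by (auto simp: projs_def)
  have "proj_le (\<phi> Q) (proj_Sup S')" if "Q \<in> S" for Q
    using that dist image S by (intro proj_Sup_upper[OF S']) (auto simp: S_def S'_def)
  then have le: "proj_le (\<phi> (proj_Sup S)) (proj_Sup S')"
    by (rule quantum_function_proj_Sup_le[OF M NB \<phi> S J'])
  then have eq: "proj_Sup S' o\<^sub>L \<phi> (proj_Sup S) = \<phi> (proj_Sup S)"
      "\<phi> (proj_Sup S) o\<^sub>L proj_Sup S' = \<phi> (proj_Sup S)"
    using proj_le_commute[OF \<phi>J J'] by (auto simp: proj_le_def)
  have "proj_Sup S \<in> M" using J by (simp add: projs_def)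
  note compl = quantum_function_complement[OF M \<phi> this]
  have nb: "nbhd M V s P = id_blinfun - proj_Sup S"
      "nbhd N W r (\<phi> P) = id_blinfun - proj_Sup S'"
    by (simp_all add: nbhd_def S_def S'_def)
  show "nbhd M V s P \<in> M" by (simp add: nb compl)
  have eq': "blinfun_apply (proj_Sup S') (blinfun_apply (\<phi> (proj_Sup S)) x) = blinfun_apply (\<phi> (proj_Sup S)) x"
    "blinfun_apply (\<phi> (proj_Sup S)) (blinfun_apply (proj_Sup S') x) = blinfun_apply (\<phi> (proj_Sup S)) x" for x
    using eq by (metis blinfun_apply_blinfun_compose)+
  show "\<phi> (nbhd M V s P) o\<^sub>L nbhd N W r (\<phi> P) = nbhd N W r (\<phi> P)"
    "nbhd N W r (\<phi> P) o\<^sub>L \<phi> (nbhd M V s P) = nbhd N W r (\<phi> P)"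
    by (rule blinfun_eqI; simp add: nb compl blinfun.diff_left blinfun.diff_right eq')+
qed

section \<open>Transfer of covers along a coarse embedding\<close>

lemma asdim_le_quantum_coarse_embedding:
  assumes M: "von_neumann_algebra M" and N: "von_neumann_algebra N"
    and emb: "quantum_coarse_embedding M V N W \<phi>" and asdim: "asdim_le M V n"
  shows "asdim_le N W n"
  unfolding asdim_le_def
proof (intro allI impI)
  fix r :: real assume "r > 0"
  have \<phi>: "quantum_function M N \<phi>" and omega: "(omega M V W \<phi> \<longlongrightarrow> \<infinity>) at_top"
    and rho: "\<And>t. t \<ge> 0 \<Longrightarrow> rho M V N W \<phi> t < \<infinity>"
    using emb by (auto simp: quantum_coarse_embedding_def)
  have NB: "N \<subseteq> bounded_ops" using N by (simp add: von_neumann_algebra_def op_subspace_def)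
  have "\<forall>\<^sub>F s in at_top. omega M V W \<phi> s > ennreal r"
    using omega by (rule order_tendstoD) simp
  then obtain s where "s > 0" and s: "omega M V W \<phi> s > ennreal r"
    using eventually_happens'[OF trivial_limit_at_top_linorder
        eventually_conj[OF _ eventually_gt_at_top[of "0 :: real"]]] by blast
  have dist: "mdist W (\<phi> P) (\<phi> Q) \<ge> ennreal r"
    if "P \<in> projs M" "Q \<in> projs M" "mdist V P Q \<ge> ennreal s" for P Q
  proof -
    have "omega M V W \<phi> s \<le> mdist W (\<phi> P) (\<phi> Q)"
      unfolding omega_def using that by (intro Inf_lower) blast
    with s show ?thesis by order
  qed
  obtain \<P> where \<P>: "\<And>i. i \<le> n \<Longrightarrow> \<P> i \<subseteq> projs M"
    and bdd: "\<And>i. i \<le> n \<Longrightarrow> uniformly_bounded M V (\<P> i)"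
    and disj: "\<And>i. i \<le> n \<Longrightarrow> r_disjoint M V s (\<P> i)" and cover: "is_cover (\<Union>i\<le>n. \<P> i)"
    using asdim \<open>s > 0\<close> unfolding asdim_le_def by metis
  show "\<exists>\<Q>. (\<forall>i\<le>n. \<Q> i \<subseteq> projs N \<and> uniformly_bounded N W (\<Q> i) \<and> r_disjoint N W r (\<Q> i)) \<and>
      is_cover (\<Union>i\<le>n. \<Q> i)"
  proof (intro exI[of _ "\<lambda>i. \<phi> ` \<P> i"] conjI allI impI)
    fix i assume i: "i \<le> n"
    show "\<phi> ` \<P> i \<subseteq> projs N" using \<P>[OF i] quantum_function_projs[OF \<phi> NB] by blast
    show "uniformly_bounded N W (\<phi> ` \<P> i)"
    proof -
      obtain R where "R > 0" and R: "(SUP P\<in>\<P> i. diam M V P) \<le> ennreal R"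
        using bdd[OF i] by (auto simp: uniformly_bounded_def)
      obtain D where "D \<ge> 0" and D: "rho M V N W \<phi> R = ennreal D"
        using rho[of R] \<open>R > 0\<close> by (cases "rho M V N W \<phi> R") auto
      \<comment> \<open>A uniform bound has to be strictly positive, while \<open>D\<close> may be
        0.\<close>
      have "diam N W (\<phi> P) \<le> ennreal (D + 1)" if "P \<in> \<P> i" for P
      proof -
        have "diam M V P \<le> ennreal R" using R that by (meson SUP_upper order_trans)
        then have "diam N W (\<phi> P) \<le> rho M V N W \<phi> R"
          unfolding rho_def using that \<P>[OF i] by (intro Sup_upper) blast
        also have "\<dots> \<le> ennreal (D + 1)" unfolding D by (simp add: ennreal_leI)
        finally show ?thesis .
      qed
      then show ?thesis
        unfolding uniformly_bounded_def using \<open>D \<ge> 0\<close>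
        by (intro exI[of _ "D + 1"]) (auto intro: SUP_least)
    qed
    show "r_disjoint N W r (\<phi> ` \<P> i)"
      unfolding r_disjoint_def ball_simps
    proof (intro ballI impI)
      fix P Q assume P: "P \<in> \<P> i" and Q: "Q \<in> \<P> i" and "\<phi> P \<noteq> \<phi> Q"
      \<comment> \<open>Distinct images come from distinct projections, so disjointness in
        \<open>M\<close> applies.\<close>
      then have "nbhd M V s P o\<^sub>L nbhd M V s Q = 0"
        using disj[OF i] by (auto simp: r_disjoint_def)
      moreover have PQ: "P \<in> projs M" "Q \<in> projs M" using P Q \<P>[OF i] by auto
      note nP = nbhd_quantum_function[where V = V and W = W, OF M N \<phi> dist[OF PQ(1)]]
      note nQ = nbhd_quantum_function[where V = V and W = W, OF M N \<phi> dist[OF PQ(2)]]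
      ultimately have "\<phi> (nbhd M V s P) o\<^sub>L \<phi> (nbhd M V s Q) = 0"
        using \<phi> nP(1) nQ(1) quantum_function_zero[OF M \<phi>] unfolding quantum_function_def by metis
      \<comment> \<open>In this sandwich the outer neighbourhoods absorb the images of the inner
        ones, which leaves just the product of the outer two.\<close>
      then have "nbhd N W r (\<phi> P) o\<^sub>L (\<phi> (nbhd M V s P) o\<^sub>L \<phi> (nbhd M V s Q)) o\<^sub>L nbhd N W r (\<phi> Q) = 0"
        by simp
      then show "nbhd N W r (\<phi> P) o\<^sub>L nbhd N W r (\<phi> Q) = 0"
        using nP(3) nQ(2) by (metis blinfun_compose_assoc)
    qed
  next
    let ?S = "\<Union>i\<le>n. \<P> i"
    have S: "?S \<subseteq> projs M" using \<P> by blast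
    have S': "projection Q" if "Q \<in> \<phi> ` ?S" for Q
      using that S quantum_function_projs[OF \<phi> NB] by (auto simp: projs_def)
    \<comment> \<open>The join of the images serves as the upper bound \<open>E\<close>; it
      dominates the image of the identity, which is the identity.\<close>
    have "proj_le (\<phi> (proj_Sup ?S)) (proj_Sup (\<phi> ` ?S))"
      by (rule quantum_function_proj_Sup_le[OF M NB \<phi> S projection_proj_Sup[OF S']])
        (auto intro!: proj_Sup_upper[OF S'])
    moreover have "\<phi> (proj_Sup ?S) = id_blinfun"
      using cover \<phi> by (simp add: is_cover_def quantum_function_def)
    ultimately have "proj_Sup (\<phi> ` ?S) o\<^sub>L id_blinfun = id_blinfun"
      by (simp only: proj_le_def)
    moreover have "proj_Sup (\<phi> ` ?S) o\<^sub>L id_blinfun = proj_Sup (\<phi> ` ?S)"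
      by (rule blinfun_eqI) simp
    ultimately have "proj_Sup (\<phi> ` ?S) = id_blinfun" by metis
    then show "is_cover (\<Union>i\<le>n. \<phi> ` \<P> i)" by (simp add: is_cover_def image_UN)
  qed
qed

theorem theorem4p6:
  fixes M :: "('h::chilbert_space \<Rightarrow>\<^sub>L 'h) set" and V :: "real \<Rightarrow> ('h \<Rightarrow>\<^sub>L 'h) set"
    and N :: "('k::chilbert_space \<Rightarrow>\<^sub>L 'k) set" and W :: "real \<Rightarrow> ('k \<Rightarrow>\<^sub>L 'k) set"
    and \<phi> :: "('h \<Rightarrow>\<^sub>L 'h) \<Rightarrow> ('k \<Rightarrow>\<^sub>L 'k)"
  assumes "quantum_metric_space M V"
    and "quantum_metric_space N W"
    and "quantum_coarse_embedding M V N W \<phi>"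
  shows "asdim N W \<le> asdim M V"
proof -
  have "asdim_le N W n" if "asdim_le M V n" for n
    using asdim_le_quantum_coarse_embedding[OF _ _ assms(3) that] assms(1,2)
    by (simp add: quantum_metric_space_def)
  \<comment> \<open>Every bound valid for \<open>M\<close> is valid for \<open>N\<close>, and the
    infimum over a larger set is smaller; an empty set for \<open>M\<close> gives the value
    infinity.\<close>
  then show ?thesis unfolding asdim_def by (intro Inf_superset_mono) blast
qed

end
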